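(* Let $G$ be a finitely generated group and let $H$ be a subgroup of $G$. Suppose there exists an integer $n>0$ such that for every integer $k>n$ and every $k$ distinct left cosets $g_1H,\dots,g_kH$ of $H$ in $G$, the intersection $\bigcap_{i=1}^{k} g_iHg_i^{-1}$ is splitting-compatible in $G$. Then $H$ is splitting-compatible in $G$.
   Context: Let $G$ be a finitely generated group and $L\le G$ a subgroup. A subset of $G$ is $L$-finite if it is contained in finitely many right cosets $Lg$ of $L$. For $A\subseteq G$ write $A^*=G\smallsetminus A$. $A$ is $L$-proper if neither $A$ nor $A^*$ is $L$-finite. $A$ is $L$-almost invariant if for every $g\in G$ the symmetric difference of $A$ and $Ag$ is $L$-finite. $G$ splits nontrivially over a subgroup $C$ if $G$ is an amalgamated free product $G=P*_C Q$ with $P\neq C\neq Q$, or an HNN-extension $G=P*_C$. Two subgroups of $G$ are commensurable if their intersection has finite index in both. The subgroup $L$ is splitting-compatible in $G$ if the following implication holds: if $G$ contains an $L$-proper $L$-almost invariant subset $A$ with $LAL=A$, then $G$ splits nontrivially over a subgroup commensurable with a subgroup of $L$. *)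

theory Defs
  imports "HOL-Algebra.Coset" "HOL-Algebra.Generated_Groups"
begin

section \<open>Almost invariant sets\<close>

definition finitely_generated :: "('a, 'm) monoid_scheme \<Rightarrow> bool" where
  "finitely_generated G \<longleftrightarrow> (\<exists>S. finite S \<and> S \<subseteq> carrier G \<and> generate G S = carrier G)"

definition coset_finite :: "('a, 'm) monoid_scheme \<Rightarrow> 'a set \<Rightarrow> 'a set \<Rightarrow> bool" where
  "coset_finite G L A \<longleftrightarrow> (\<exists>F. finite F \<and> F \<subseteq> rcosets\<^bsub>G\<^esub> L \<and> A \<subseteq> \<Union>F)"

definition coset_proper :: "('a, 'm) monoid_scheme \<Rightarrow> 'a set \<Rightarrow> 'a set \<Rightarrow> bool" where
  "coset_proper G L A \<longleftrightarrow> \<not> coset_finite G L A \<and> \<not> coset_finite G L (carrier G - A)"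

definition almost_invariant :: "('a, 'm) monoid_scheme \<Rightarrow> 'a set \<Rightarrow> 'a set \<Rightarrow> bool" where
  "almost_invariant G L A \<longleftrightarrow> (\<forall>g\<in>carrier G. coset_finite G L (sym_diff A (A #>\<^bsub>G\<^esub> g)))"

definition commensurable :: "('a, 'm) monoid_scheme \<Rightarrow> 'a set \<Rightarrow> 'a set \<Rightarrow> bool" where
  "commensurable G H K \<longleftrightarrow>
     finite (rcosets\<^bsub>G\<lparr>carrier := H\<rparr>\<^esub> (H \<inter> K)) \<and> finite (rcosets\<^bsub>G\<lparr>carrier := K\<rparr>\<^esub> (H \<inter> K))"


section \<open>Presentations\<close>

text \<open>The congruence on the free monoid of words over \<open>X\<close> generated by the pairs of words in \<open>R\<close>.\<close>

inductive_set word_cong :: "'x set \<Rightarrow> 'x list rel \<Rightarrow> 'x list rel" for X R where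
  refl: "w \<in> lists X \<Longrightarrow> (w, w) \<in> word_cong X R"
| sym: "(u, v) \<in> word_cong X R \<Longrightarrow> (v, u) \<in> word_cong X R"
| trans: "(u, v) \<in> word_cong X R \<Longrightarrow> (v, w) \<in> word_cong X R \<Longrightarrow> (u, w) \<in> word_cong X R"
| rel: "(u, v) \<in> R \<Longrightarrow> u \<in> lists X \<Longrightarrow> v \<in> lists X \<Longrightarrow> x \<in> lists X \<Longrightarrow> y \<in> lists X
         \<Longrightarrow> (x @ u @ y, x @ v @ y) \<in> word_cong X R"

text \<open>This is a monoid presentation. It is a group as soon as the relations make every generator
  invertible, which is the case in the two instances below.\<close>

definition presented :: "'x set \<Rightarrow> 'x list rel \<Rightarrow> 'x list set monoid" where
  "presented X R = \<lparr>carrier = lists X // word_cong X R,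
     monoid.mult = (\<lambda>U V. \<Union>u\<in>U. \<Union>v\<in>V. word_cong X R `` {u @ v}),
     one = word_cong X R `` {[]}\<rparr>"

lemma word_cong_lists: "(u, v) \<in> word_cong X R \<Longrightarrow> u \<in> lists X \<and> v \<in> lists X"
  by (induction rule: word_cong.induct) auto

lemma equiv_word_cong: "equiv (lists X) (word_cong X R)"
  by (rule equivI)
     (auto intro!: refl_onI symI transI dest: word_cong_lists
           intro: word_cong.refl word_cong.sym word_cong.trans)

lemma word_cong_context:
  assumes "(u, v) \<in> word_cong X R" "x \<in> lists X" "y \<in> lists X"
  shows "(x @ u @ y, x @ v @ y) \<in> word_cong X R"
  using assms
proof (induction rule: word_cong.induct)
  case (refl w)
  then show ?case by (intro word_cong.refl) auto
next
  case (sym u v)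
  then show ?case by (blast intro: word_cong.sym)
next
  case (trans u v w)
  then show ?case by (blast intro: word_cong.trans)
next
  case (rel u v a b)
  then have "((x @ a) @ u @ (b @ y), (x @ a) @ v @ (b @ y)) \<in> word_cong X R"
    by (intro word_cong.rel) auto
  then show ?case by simp
qed

lemma word_cong_append:
  assumes "(u, u') \<in> word_cong X R" "(v, v') \<in> word_cong X R"
  shows "(u @ v, u' @ v') \<in> word_cong X R"
proof -
  have "([] @ u @ v, [] @ u' @ v) \<in> word_cong X R"
    using assms assms[THEN word_cong_lists] by (intro word_cong_context) auto
  moreover have "(u' @ v @ [], u' @ v' @ []) \<in> word_cong X R"
    using assms assms[THEN word_cong_lists] by (intro word_cong_context) auto
  ultimately show ?thesis by (auto intro: word_cong.trans)
qed

lemma presented_mult: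
  assumes "u \<in> lists X" "v \<in> lists X"
  shows "word_cong X R `` {u} \<otimes>\<^bsub>presented X R\<^esub> word_cong X R `` {v} = word_cong X R `` {u @ v}"
proof -
  have "word_cong X R `` {u' @ v'} = word_cong X R `` {u @ v}"
    if "(u, u') \<in> word_cong X R" "(v, v') \<in> word_cong X R" for u' v'
    using word_cong_append[OF that] equiv_class_eq[OF equiv_word_cong] by metis
  then show ?thesis
    using assms by (auto simp: presented_def intro: word_cong.refl)
qed

lemma presented_carrier:
  "carrier (presented X R) = {word_cong X R `` {w} |w. w \<in> lists X}"
  by (auto simp: presented_def quotient_def)

lemma presented_group:
  assumes inv: "\<And>x. x \<in> X \<Longrightarrow> \<exists>w\<in>lists X. (w @ [x], []) \<in> word_cong X R"
  shows "group (presented X R)"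
proof -
  have one: "\<one>\<^bsub>presented X R\<^esub> = word_cong X R `` {[]}"
    by (simp add: presented_def)
  have word_inv: "\<exists>w'\<in>lists X. (w' @ w, []) \<in> word_cong X R" if "w \<in> lists X" for w
    using that
  proof (induction w)
    case Nil
    then show ?case by (auto intro!: bexI[of _ "[]"] word_cong.refl)
  next
    case (Cons x w)
    then obtain w' x' where w': "w' \<in> lists X" "(w' @ w, []) \<in> word_cong X R"
      and x': "x' \<in> lists X" "(x' @ [x], []) \<in> word_cong X R"
      using inv[of x] by auto
    have "(w' @ (x' @ [x]) @ w, w' @ [] @ w) \<in> word_cong X R"
      using Cons.hyps Cons.prems w' x' by (intro word_cong_context) auto
    with w' x' show ?case
      by (intro bexI[of _ "w' @ x'"]) (auto intro: word_cong.trans)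
  qed
  show ?thesis
  proof (rule groupI)
    fix U assume "U \<in> carrier (presented X R)"
    then obtain u where u: "u \<in> lists X" "U = word_cong X R `` {u}"
      by (auto simp: presented_carrier)
    then obtain w where w: "w \<in> lists X" "(w @ u, []) \<in> word_cong X R"
      using word_inv by blast
    have "word_cong X R `` {w} \<otimes>\<^bsub>presented X R\<^esub> U = \<one>\<^bsub>presented X R\<^esub>"
      using u w equiv_class_eq[OF equiv_word_cong w(2)] by (simp add: presented_mult one)
    then show "\<exists>V\<in>carrier (presented X R). V \<otimes>\<^bsub>presented X R\<^esub> U = \<one>\<^bsub>presented X R\<^esub>"
      using w by (auto simp: presented_carrier)
  next
    show "\<one>\<^bsub>presented X R\<^esub> \<in> carrier (presented X R)"
      unfolding one presented_carrier by (auto intro!: exI[of _ "[]"])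
  next
    fix U assume "U \<in> carrier (presented X R)"
    then obtain u where u: "u \<in> lists X" "U = word_cong X R `` {u}"
      by (auto simp: presented_carrier)
    then show "\<one>\<^bsub>presented X R\<^esub> \<otimes>\<^bsub>presented X R\<^esub> U = U"
      by (simp add: one presented_mult)
  next
    fix U V assume "U \<in> carrier (presented X R)" "V \<in> carrier (presented X R)"
    then obtain u v where "u \<in> lists X" "U = word_cong X R `` {u}"
      "v \<in> lists X" "V = word_cong X R `` {v}"
      by (auto simp: presented_carrier)
    then show "U \<otimes>\<^bsub>presented X R\<^esub> V \<in> carrier (presented X R)"
      by (auto simp: presented_mult) (auto simp: presented_carrier intro!: exI[of _ "u @ v"])
  next
    fix U V W
    assume "U \<in> carrier (presented X R)" "V \<in> carrier (presented X R)" "W \<in> carrier (presented X R)"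
    then obtain u v w where "u \<in> lists X" "U = word_cong X R `` {u}"
      "v \<in> lists X" "V = word_cong X R `` {v}" "w \<in> lists X" "W = word_cong X R `` {w}"
      by (auto simp: presented_carrier)
    then show "U \<otimes>\<^bsub>presented X R\<^esub> V \<otimes>\<^bsub>presented X R\<^esub> W
             = U \<otimes>\<^bsub>presented X R\<^esub> (V \<otimes>\<^bsub>presented X R\<^esub> W)"
      by (simp add: presented_mult)
  qed
qed


section \<open>Amalgamated free products and HNN-extensions\<close>

definition amalg_gens :: "('a, 'm) monoid_scheme \<Rightarrow> ('b, 'n) monoid_scheme \<Rightarrow> ('a + 'b) set" where
  "amalg_gens P Q = carrier P <+> carrier Q"

definition amalg_rels ::
  "('a, 'm) monoid_scheme \<Rightarrow> ('b, 'n) monoid_scheme \<Rightarrow> 'a set \<Rightarrow> ('a \<Rightarrow> 'b) \<Rightarrow> ('a + 'b) list rel" where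
  "amalg_rels P Q C \<phi> =
     {([Inl x, Inl y], [Inl (x \<otimes>\<^bsub>P\<^esub> y)]) |x y. x \<in> carrier P \<and> y \<in> carrier P}
   \<union> {([Inr x, Inr y], [Inr (x \<otimes>\<^bsub>Q\<^esub> y)]) |x y. x \<in> carrier Q \<and> y \<in> carrier Q}
   \<union> {([Inl \<one>\<^bsub>P\<^esub>], []), ([Inr \<one>\<^bsub>Q\<^esub>], [])}
   \<union> {([Inl c], [Inr (\<phi> c)]) |c. c \<in> C}"

text \<open>The amalgamated free product of \<open>P\<close> and \<open>Q\<close>, where the subgroup \<open>C\<close> of \<open>P\<close> is identified with
  a subgroup of \<open>Q\<close> along the monomorphism \<open>\<phi>\<close>.\<close>

definition amalgam ::
  "('a, 'm) monoid_scheme \<Rightarrow> ('b, 'n) monoid_scheme \<Rightarrow> 'a set \<Rightarrow> ('a \<Rightarrow> 'b) \<Rightarrow> ('a + 'b) list set monoid"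
  where "amalgam P Q C \<phi> = presented (amalg_gens P Q) (amalg_rels P Q C \<phi>)"

definition amalgam_class ::
  "('a, 'm) monoid_scheme \<Rightarrow> ('b, 'n) monoid_scheme \<Rightarrow> 'a set \<Rightarrow> ('a \<Rightarrow> 'b) \<Rightarrow> 'a + 'b
    \<Rightarrow> ('a + 'b) list set"
  where "amalgam_class P Q C \<phi> x = word_cong (amalg_gens P Q) (amalg_rels P Q C \<phi>) `` {[x]}"

datatype 'a hnn_gen = Base 'a | Stable | Stable_inv

definition hnn_gens :: "('a, 'm) monoid_scheme \<Rightarrow> 'a hnn_gen set" where
  "hnn_gens P = Base ` carrier P \<union> {Stable, Stable_inv}"

definition hnn_rels ::
  "('a, 'm) monoid_scheme \<Rightarrow> 'a set \<Rightarrow> ('a \<Rightarrow> 'a) \<Rightarrow> 'a hnn_gen list rel" where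
  "hnn_rels P C \<theta> =
     {([Base x, Base y], [Base (x \<otimes>\<^bsub>P\<^esub> y)]) |x y. x \<in> carrier P \<and> y \<in> carrier P}
   \<union> {([Base \<one>\<^bsub>P\<^esub>], []), ([Stable, Stable_inv], []), ([Stable_inv, Stable], [])}
   \<union> {([Stable, Base c, Stable_inv], [Base (\<theta> c)]) |c. c \<in> C}"

text \<open>The HNN-extension of \<open>P\<close> with stable letter \<open>t\<close>, associated subgroups \<open>C\<close> and \<open>\<theta> ` C\<close>, and
  \<open>t c t\<^sup>-\<^sup>1 = \<theta> c\<close> for \<open>c \<in> C\<close>, where \<open>\<theta>\<close> is a monomorphism from \<open>C\<close> to \<open>P\<close>.\<close>

definition hnn_extension ::
  "('a, 'm) monoid_scheme \<Rightarrow> 'a set \<Rightarrow> ('a \<Rightarrow> 'a) \<Rightarrow> 'a hnn_gen list set monoid"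
  where "hnn_extension P C \<theta> = presented (hnn_gens P) (hnn_rels P C \<theta>)"

definition hnn_class ::
  "('a, 'm) monoid_scheme \<Rightarrow> 'a set \<Rightarrow> ('a \<Rightarrow> 'a) \<Rightarrow> 'a hnn_gen \<Rightarrow> 'a hnn_gen list set"
  where "hnn_class P C \<theta> x = word_cong (hnn_gens P) (hnn_rels P C \<theta>) `` {[x]}"

lemma amalgam_group:
  assumes "group P" "group Q"
  shows "group (amalgam P Q C \<phi>)"
  unfolding amalgam_def
proof (rule presented_group)
  interpret P: group P by fact
  interpret Q: group Q by fact
  let ?X = "amalg_gens P Q" and ?R = "amalg_rels P Q C \<phi>"
  have rel: "(u, v) \<in> word_cong ?X ?R" if "(u, v) \<in> ?R" "u \<in> lists ?X" "v \<in> lists ?X" for u v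
    using word_cong.rel[OF that, of "[]" "[]"] by simp
  fix x assume "x \<in> ?X"
  then consider (L) p where "p \<in> carrier P" "x = Inl p" | (R) q where "q \<in> carrier Q" "x = Inr q"
    by (auto simp: amalg_gens_def)
  then show "\<exists>w\<in>lists ?X. (w @ [x], []) \<in> word_cong ?X ?R"
  proof cases
    case L
    have "([Inl (inv\<^bsub>P\<^esub> p), Inl p], [Inl (inv\<^bsub>P\<^esub> p \<otimes>\<^bsub>P\<^esub> p)]) \<in> word_cong ?X ?R"
      using L by (intro rel) (auto simp: amalg_rels_def amalg_gens_def simp del: P.l_inv)
    moreover have "([Inl \<one>\<^bsub>P\<^esub>], []) \<in> word_cong ?X ?R"
      by (intro rel) (auto simp: amalg_rels_def amalg_gens_def)
    ultimately show ?thesis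
      using L by (intro bexI[of _ "[Inl (inv\<^bsub>P\<^esub> p)]"])
        (auto simp: amalg_gens_def intro: word_cong.trans)
  next
    case R
    have "([Inr (inv\<^bsub>Q\<^esub> q), Inr q], [Inr (inv\<^bsub>Q\<^esub> q \<otimes>\<^bsub>Q\<^esub> q)]) \<in> word_cong ?X ?R"
      using R by (intro rel) (auto simp: amalg_rels_def amalg_gens_def simp del: Q.l_inv)
    moreover have "([Inr \<one>\<^bsub>Q\<^esub>], []) \<in> word_cong ?X ?R"
      by (intro rel) (auto simp: amalg_rels_def amalg_gens_def)
    ultimately show ?thesis
      using R by (intro bexI[of _ "[Inr (inv\<^bsub>Q\<^esub> q)]"])
        (auto simp: amalg_gens_def intro: word_cong.trans)
  qed
qed

lemma hnn_extension_group:
  assumes "group P"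
  shows "group (hnn_extension P C \<theta>)"
  unfolding hnn_extension_def
proof (rule presented_group)
  interpret P: group P by fact
  let ?X = "hnn_gens P" and ?R = "hnn_rels P C \<theta>"
  have rel: "(u, v) \<in> word_cong ?X ?R" if "(u, v) \<in> ?R" "u \<in> lists ?X" "v \<in> lists ?X" for u v
    using word_cong.rel[OF that, of "[]" "[]"] by simp
  fix x assume "x \<in> ?X"
  then consider (B) p where "p \<in> carrier P" "x = Base p" | (S) "x = Stable" | (I) "x = Stable_inv"
    by (auto simp: hnn_gens_def)
  then show "\<exists>w\<in>lists ?X. (w @ [x], []) \<in> word_cong ?X ?R"
  proof cases
    case B
    have "([Base (inv\<^bsub>P\<^esub> p), Base p], [Base (inv\<^bsub>P\<^esub> p \<otimes>\<^bsub>P\<^esub> p)]) \<in> word_cong ?X ?R"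
      using B by (intro rel) (auto simp: hnn_rels_def hnn_gens_def simp del: P.l_inv)
    moreover have "([Base \<one>\<^bsub>P\<^esub>], []) \<in> word_cong ?X ?R"
      by (intro rel) (auto simp: hnn_rels_def hnn_gens_def)
    ultimately show ?thesis
      using B by (intro bexI[of _ "[Base (inv\<^bsub>P\<^esub> p)]"])
        (auto simp: hnn_gens_def intro: word_cong.trans)
  next
    case S
    have "([Stable_inv, Stable], []) \<in> word_cong ?X ?R"
      by (intro rel) (auto simp: hnn_rels_def hnn_gens_def)
    with S show ?thesis
      by (intro bexI[of _ "[Stable_inv]"]) (auto simp: hnn_gens_def)
  next
    case I
    have "([Stable, Stable_inv], []) \<in> word_cong ?X ?R"
      by (intro rel) (auto simp: hnn_rels_def hnn_gens_def)
    with I show ?thesis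
      by (intro bexI[of _ "[Stable]"]) (auto simp: hnn_gens_def)
  qed
qed


section \<open>Splittings\<close>

text \<open>The factors of an amalgamated free product, and the base group of an HNN-extension, embed, so
  a decomposition of \<open>G\<close> over the subgroup \<open>C\<close> is given by subgroups of \<open>G\<close> (and, for
  HNN-extensions, an element \<open>t\<close> of \<open>G\<close>) such that the natural homomorphism from the abstract
  construction to \<open>G\<close> is an isomorphism.\<close>

definition is_amalgam ::
  "('a, 'm) monoid_scheme \<Rightarrow> 'a set \<Rightarrow> 'a set \<Rightarrow> 'a set \<Rightarrow> bool" where
  "is_amalgam G P Q C \<longleftrightarrow>
     subgroup P G \<and> subgroup Q G \<and> subgroup C G \<and> C \<subseteq> P \<and> C \<subseteq> Q \<and>
     (let P' = G\<lparr>carrier := P\<rparr>; Q' = G\<lparr>carrier := Q\<rparr> in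
       \<exists>f\<in>iso (amalgam P' Q' C (\<lambda>c. c)) G.
         (\<forall>p\<in>P. f (amalgam_class P' Q' C (\<lambda>c. c) (Inl p)) = p) \<and>
         (\<forall>q\<in>Q. f (amalgam_class P' Q' C (\<lambda>c. c) (Inr q)) = q))"

definition is_hnn_extension ::
  "('a, 'm) monoid_scheme \<Rightarrow> 'a set \<Rightarrow> 'a set \<Rightarrow> 'a \<Rightarrow> bool" where
  "is_hnn_extension G P C t \<longleftrightarrow>
     subgroup P G \<and> subgroup C G \<and> C \<subseteq> P \<and> t \<in> carrier G \<and>
     (let P' = G\<lparr>carrier := P\<rparr>; \<theta> = (\<lambda>c. t \<otimes>\<^bsub>G\<^esub> c \<otimes>\<^bsub>G\<^esub> inv\<^bsub>G\<^esub> t) in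
       \<theta> ` C \<subseteq> P \<and>
       (\<exists>f\<in>iso (hnn_extension P' C \<theta>) G.
         (\<forall>p\<in>P. f (hnn_class P' C \<theta> (Base p)) = p) \<and>
         f (hnn_class P' C \<theta> Stable) = t))"

definition splits_nontrivially_over :: "('a, 'm) monoid_scheme \<Rightarrow> 'a set \<Rightarrow> bool" where
  "splits_nontrivially_over G C \<longleftrightarrow>
     (\<exists>P Q. is_amalgam G P Q C \<and> P \<noteq> C \<and> C \<noteq> Q) \<or> (\<exists>P t. is_hnn_extension G P C t)"

definition splitting_compatible :: "('a, 'm) monoid_scheme \<Rightarrow> 'a set \<Rightarrow> bool" where
  "splitting_compatible G L \<longleftrightarrow>
     ((\<exists>A\<subseteq>carrier G. coset_proper G L A \<and> almost_invariant G L A \<and> L <#>\<^bsub>G\<^esub> A <#>\<^bsub>G\<^esub> L = A)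
      \<longrightarrow> (\<exists>C K. splits_nontrivially_over G C \<and> subgroup K G \<and> K \<subseteq> L \<and> commensurable G C K))"

end

theory Submission
  imports Defs
begin

text \<open>
  For a finite set \<open>S\<close> of left cosets of \<open>H\<close> with \<open>H \<in> S\<close>, let \<open>L\<close> be its pointwise stabilizer, that
  is, the intersection of the corresponding conjugates of \<open>H\<close>. If some \<open>S\<close> with more than \<open>n\<close>
  elements admits an \<open>L\<close>-proper \<open>L\<close>-almost invariant set \<open>A = L A H\<close>, the hypothesis applies.
  Otherwise choose such an \<open>S\<close> of maximal size. For each \<open>g\<close>, one of the four corners of \<open>A\<close> and
  \<open>g A\<close> is almost invariant over \<open>L \<inter> g L g\<^sup>-\<^sup>1\<close>, the stabilizer of \<open>S \<union> g S\<close>. If \<open>g S \<noteq> S\<close>,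
  maximality forces this corner to be empty: it cannot be proper, and if it were finite and contained
  \<open>x\<close>, it would contain \<open>x L\<close>, so that \<open>x A\<close> would be a proper almost invariant set over the
  stabilizer of \<open>S \<union> g S \<union> x S\<close>. The setwise stabilizer of \<open>S\<close> contains \<open>L\<close> with finite index, and
  replacing \<open>A\<close> by an atom of the Boolean algebra generated by its finitely many translates under this
  group yields a set that is nested with all its translates. These are the half-spaces of a tree
  (Dunwoody), and playing ping-pong with them identifies \<open>G\<close> with an amalgam or an HNN-extension over
  the stabilizer of a half-space, which is commensurable with \<open>L\<close>.
\<close>

section \<open>Ping-pong for amalgams and HNN-extensions\<close>

text \<open>The bound \<open>n\<close> serves to give the maximal \<open>S\<close> when no large one
  works. Keeping \<open>H\<close> in \<open>S\<close> keeps L inside \<open>H\<close>, so A = L A H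
  implies A = L A L, and the right-hand symmetry of A survives while L shrinks. The corner of X and
  g Y that is used is the one with g outside X and 1 outside g Y. Right symmetry spreads these two
  non-memberships over the cosets g L and L. A missed coset is what bounds the coboundary of the
  corner by cosets of the intersection of L and g L g^-1, and not merely by cosets of L or of its
  conjugate. If g S = S, then S does not grow and maximality says nothing about g; this is why atoms
  are needed. Replacing A by an atom is harmless, since the corner argument applies to every proper
  almost invariant set over L with the right symmetry. In the final step, normal form theorems are
  replaced by shortest words: a nonempty shortest word moves a half-space to a place where the
  identity cannot move it.\<close>

lemma word_cong_rel: 
  "(u, v) \<in> R \<Longrightarrow> u \<in> lists X \<Longrightarrow> v \<in> lists X \<Longrightarrow> (u, v) \<in> word_cong X R"
  using word_cong.rel[of u v R X "[]" "[]"] by simp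

context group
begin

section \<open>Evaluation of words in a group\<close>

definition word_val :: "('x \<Rightarrow> 'a) \<Rightarrow> 'x list \<Rightarrow> 'a" where
  "word_val v w = foldr (\<lambda>x y. v x \<otimes> y) w \<one>"

lemma word_val_simps [simp]:
  "word_val v [] = \<one>"
  "word_val v (x # w) = v x \<otimes> word_val v w"
  by (simp_all add: word_val_def)

lemma word_val_closed: "v ` X \<subseteq> carrier G \<Longrightarrow> w \<in> lists X \<Longrightarrow> word_val v w \<in> carrier G"
  by (induction w) auto

lemma word_val_append:
  assumes "v ` X \<subseteq> carrier G" "u \<in> lists X" "w \<in> lists X"
  shows "word_val v (u @ w) = word_val v u \<otimes> word_val v w"
  using assms(2)
proof (induction u)
  case (Cons x u)
  then have "v x \<in> carrier G" "word_val v u \<in> carrier G" "word_val v w \<in> carrier G"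
    using assms word_val_closed[OF assms(1)] by auto
  with Cons show ?case by (simp add: m_assoc)
qed (use assms word_val_closed[OF assms(1,3)] in simp)

lemma word_val_cong:
  assumes "v ` X \<subseteq> carrier G"
    and R: "\<And>u w. (u, w) \<in> R \<Longrightarrow> u \<in> lists X \<Longrightarrow> w \<in> lists X \<Longrightarrow> word_val v u = word_val v w"
    and "(u, w) \<in> word_cong X R"
  shows "word_val v u = word_val v w"
  using assms(3)
proof (induction rule: word_cong.induct)
  case (rel u w x y)
  then show ?case
    using R[OF rel(1-3)] by (simp add: word_val_append[OF assms(1)])
qed auto

text \<open>Injectivity of evaluation without normal forms: every class has a shortest
  representative, so it suffices that a shortest word of value one is empty. The ping-pong arguments
  enter through \<open>minimal\<close>.\<close>

lemma presented_iso:
  assumes v: "v ` X \<subseteq> carrier G"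
    and R: "\<And>u w. (u, w) \<in> R \<Longrightarrow> u \<in> lists X \<Longrightarrow> w \<in> lists X \<Longrightarrow> word_val v u = word_val v w"
    and grp: "group (presented X R)"
    and surj: "\<And>g. g \<in> carrier G \<Longrightarrow> \<exists>w\<in>lists X. word_val v w = g"
    and minimal: "\<And>w. \<lbrakk>w \<in> lists X; word_val v w = \<one>;
       \<And>w'. (w, w') \<in> word_cong X R \<Longrightarrow> length w \<le> length w'\<rbrakk> \<Longrightarrow> w = []"
  shows "\<exists>f\<in>iso (presented X R) G. \<forall>w\<in>lists X. f (word_cong X R `` {w}) = word_val v w"
proof -
  define f where "f = (\<lambda>U. the_elem (word_val v ` U))"
  have f: "f (word_cong X R `` {w}) = word_val v w" if "w \<in> lists X" for w
  proof -
    have "word_val v ` (word_cong X R `` {w}) = {word_val v w}"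
      using that word_val_cong[OF v R] by (force intro: word_cong.refl)
    then show ?thesis by (simp add: f_def)
  qed
  have trivial: "(w, []) \<in> word_cong X R" if w: "w \<in> lists X" "word_val v w = \<one>" for w
  proof -
    obtain w' where w': "(w, w') \<in> word_cong X R"
      and least: "\<And>u. (w, u) \<in> word_cong X R \<Longrightarrow> length w' \<le> length u"
      using ex_has_least_nat[of "\<lambda>u. (w, u) \<in> word_cong X R" w length] word_cong.refl[OF w(1)]
      by blast
    have "w' = []"
      using w' w least word_cong_lists[OF w'] word_val_cong[OF v R w']
      by (intro minimal) (auto intro: word_cong.trans)
    with w' show ?thesis by simp
  qed
  have hom: "f \<in> hom (presented X R) G"
  proof (rule homI)
    fix U assume "U \<in> carrier (presented X R)"
    then obtain u where "u \<in> lists X" "U = word_cong X R `` {u}"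
      unfolding presented_carrier by blast
    then show "f U \<in> carrier G"
      using f word_val_closed[OF v] by metis
  next
    fix U V assume "U \<in> carrier (presented X R)" "V \<in> carrier (presented X R)"
    then obtain u w where "u \<in> lists X" "U = word_cong X R `` {u}"
      "w \<in> lists X" "V = word_cong X R `` {w}"
      by (auto simp: presented_carrier)
    then show "f (U \<otimes>\<^bsub>presented X R\<^esub> V) = f U \<otimes> f V"
      by (simp add: presented_mult f word_val_append[OF v])
  qed
  interpret h: group_hom "presented X R" G f
    using hom grp by (simp add: group_hom_def group_hom_axioms_def is_group)
  have "inj_on f (carrier (presented X R))"
    unfolding h.inj_on_one_iff
  proof (intro allI impI)
    fix U assume "U \<in> carrier (presented X R)" and 1: "f U = \<one>"
    then obtain u where u: "u \<in> lists X" "U = word_cong X R `` {u}"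
      by (auto simp: presented_carrier)
    then have "(u, []) \<in> word_cong X R"
      using 1 f trivial by auto
    then show "U = \<one>\<^bsub>presented X R\<^esub>"
      using u equiv_class_eq[OF equiv_word_cong] by (simp add: presented_def)
  qed
  moreover have "f ` carrier (presented X R) = carrier G"
  proof
    show "carrier G \<subseteq> f ` carrier (presented X R)"
    proof
      fix g assume "g \<in> carrier G"
      then obtain w where "w \<in> lists X" "word_val v w = g" using surj by blast
      then show "g \<in> f ` carrier (presented X R)"
        by (intro image_eqI[of _ _ "word_cong X R `` {w}"]) (auto simp: f presented_carrier)
    qed
  qed auto
  ultimately have "f \<in> iso (presented X R) G"
    using hom by (simp add: iso_def bij_betw_def)
  with f show ?thesis by blast
qed

text \<open>Every congruence from a word to a strictly shorter one thus forbids the longer word as a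
  factor of a shortest word.\<close>

lemma minimal_word_no_factor:
  assumes "\<And>w'. (w, w') \<in> word_cong X R \<Longrightarrow> length w \<le> length w'"
    and "w \<in> lists X" "w = x @ u @ y" "(u, u') \<in> word_cong X R"
  shows "length u \<le> length u'"
proof -
  have "(x @ u @ y, x @ u' @ y) \<in> word_cong X R"
    using assms by (intro word_cong_context) auto
  then have "length w \<le> length (x @ u' @ y)" using assms by blast
  then show ?thesis using assms by simp
qed

text \<open>\<open>generate\<close> admits inverses and words do not, hence the demand that the
  values of the letters be closed under inversion.\<close>

lemma generate_word_val:
  assumes v: "v ` X \<subseteq> carrier G"
    and inv: "\<And>x. x \<in> X \<Longrightarrow> inv (v x) \<in> v ` X"
    and "g \<in> generate G (v ` X)"
  shows "\<exists>w\<in>lists X. word_val v w = g"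
proof -
  have single: "\<exists>w\<in>lists X. word_val v w = g" if "g \<in> v ` X" for g
  proof -
    from that obtain x where "x \<in> X" "g = v x" by blast
    then show ?thesis using v by (intro bexI[of _ "[x]"]) auto
  qed
  show ?thesis
    using assms(3)
  proof (induction rule: generate.induct)
    case one
    then show ?case by (intro bexI[of _ "[]"]) auto
  next
    case (incl h)
    then show ?case by (rule single)
  next
    case (inv h)
    then show ?case using assms(2) by (intro single) auto
  next
    case (eng g h)
    then obtain u w where "u \<in> lists X" "word_val v u = g" "w \<in> lists X" "word_val v w = h"
      by blast
    then show ?case
      by (intro bexI[of _ "u @ w"]) (auto simp: word_val_append[OF v])
  qed
qed

section \<open>Left translation of sets\<close>

lemma mem_l_coset:
  "g \<in> carrier G \<Longrightarrow> A \<subseteq> carrier G \<Longrightarrow> y \<in> g <# A \<longleftrightarrow> y \<in> carrier G \<and> inv g \<otimes> y \<in> A"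
  by (force simp: l_coset_def m_assoc[symmetric])

lemma l_coset_mono: "A \<subseteq> B \<Longrightarrow> g <# A \<subseteq> g <# B"
  by (auto simp: l_coset_def)

lemma l_coset_inv_cancel:
  "g \<in> carrier G \<Longrightarrow> A \<subseteq> carrier G \<Longrightarrow> inv g <# (g <# A) = A"
  "g \<in> carrier G \<Longrightarrow> A \<subseteq> carrier G \<Longrightarrow> g <# (inv g <# A) = A"
  by (simp_all add: lcos_m_assoc lcos_mult_one)

lemma l_coset_le_iff:
  assumes "g \<in> carrier G" "A \<subseteq> carrier G" "B \<subseteq> carrier G"
  shows "g <# A \<subseteq> g <# B \<longleftrightarrow> A \<subseteq> B"
  using l_coset_mono[of "g <# A" "g <# B" "inv g"] l_coset_mono[of A B g] assms
  by (auto simp: l_coset_inv_cancel)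

lemma l_coset_eq_iff:
  assumes "g \<in> carrier G" "A \<subseteq> carrier G" "B \<subseteq> carrier G"
  shows "g <# A = g <# B \<longleftrightarrow> A = B"
  using l_coset_le_iff[of g A B] l_coset_le_iff[of g B A] assms by auto

lemma l_coset_less_iff:
  assumes "g \<in> carrier G" "A \<subseteq> carrier G" "B \<subseteq> carrier G"
  shows "g <# A \<subset> g <# B \<longleftrightarrow> A \<subset> B"
  using l_coset_le_iff[OF assms] l_coset_eq_iff[OF assms] by (auto simp: psubset_eq)

lemma l_coset_compl:
  assumes "g \<in> carrier G" "A \<subseteq> carrier G"
  shows "g <# (carrier G - A) = carrier G - (g <# A)"
  using assms by (auto simp: mem_l_coset)

text \<open>Elements of P outside C throw the complement of A into A, those of Q outside C throw A
  into the complement, so an alternating word cannot act as the identity. Strictness in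
  \<open>PA\<close> serves the words whose first and last letters come from different factors: there
  a plain inclusion would only place a set inside itself.\<close>

lemma is_amalgamI:
  assumes P: "subgroup P G" and Q: "subgroup Q G" and C: "subgroup C G" "C \<subseteq> P" "C \<subseteq> Q"
    and gen: "generate G (P \<union> Q) = carrier G"
    and A: "A \<subseteq> carrier G" "A \<noteq> {}" "A \<noteq> carrier G"
    and PA: "\<And>p. p \<in> P - C \<Longrightarrow> p <# (carrier G - A) \<subset> A"
    and QA: "\<And>q. q \<in> Q - C \<Longrightarrow> q <# A \<subseteq> carrier G - A"
  shows "is_amalgam G P Q C"
proof -
  let ?P = "G\<lparr>carrier := P\<rparr>" and ?Q = "G\<lparr>carrier := Q\<rparr>"
  let ?X = "amalg_gens ?P ?Q" and ?R = "amalg_rels ?P ?Q C (\<lambda>c. c)"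
  let ?v = "case_sum (\<lambda>p. p) (\<lambda>q. q) :: 'a + 'a \<Rightarrow> 'a"
  let ?B = "carrier G - A"
  interpret P: subgroup P G by fact
  interpret Q: subgroup Q G by fact
  interpret C: subgroup C G by fact
  have X: "Inl p \<in> ?X \<longleftrightarrow> p \<in> P" "Inr q \<in> ?X \<longleftrightarrow> q \<in> Q" for p q
    by (auto simp: amalg_gens_def)
  have v: "?v ` ?X \<subseteq> carrier G"
    by (auto simp: amalg_gens_def)
  have vX: "?v ` ?X = P \<union> Q"
    by (force simp: amalg_gens_def)
  have relI: "(u, w) \<in> word_cong ?X ?R" if "(u, w) \<in> ?R" "u \<in> lists ?X" "w \<in> lists ?X" for u w
    using that by (rule word_cong_rel)
  have PP: "([Inl x, Inl y], [Inl (x \<otimes> y)]) \<in> word_cong ?X ?R" if "x \<in> P" "y \<in> P" for x y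
    using that by (intro relI) (auto simp: X amalg_rels_def)
  have QQ: "([Inr x, Inr y], [Inr (x \<otimes> y)]) \<in> word_cong ?X ?R" if "x \<in> Q" "y \<in> Q" for x y
    using that by (intro relI) (auto simp: X amalg_rels_def)
  have PQ: "([Inl c], [Inr c]) \<in> word_cong ?X ?R" if "c \<in> C" for c
    using that C by (intro relI) (auto simp: X amalg_rels_def)
  have P1: "([Inl \<one>], []) \<in> word_cong ?X ?R"
    by (intro relI) (auto simp: X amalg_rels_def)
  have Q1: "([Inr \<one>], []) \<in> word_cong ?X ?R"
    by (intro relI) (auto simp: X amalg_rels_def)
  \<comment> \<open>Every other pair shortens to one letter: letters of one factor multiply, and a
    letter in C can be rewritten as a letter of the other factor.\<close>
  define red where "red = (\<lambda>x y :: 'a + 'a. isl x \<noteq> isl y \<and> ?v x \<notin> C \<and> ?v y \<notin> C)"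
  have short: "\<exists>z. ([x, y], [z]) \<in> word_cong ?X ?R" if xy: "x \<in> ?X" "y \<in> ?X" "\<not> red x y" for x y
  proof (cases x; cases y)
    fix p p' assume "x = Inl p" "y = Inl p'"
    then show ?thesis using PP xy by (auto simp: X)
  next
    fix q q' assume "x = Inr q" "y = Inr q'"
    then show ?thesis using QQ xy by (auto simp: X)
  next
    fix p q assume eq: "x = Inl p" "y = Inr q"
    then consider "p \<in> C" | "q \<in> C" using xy by (auto simp: red_def)
    then show ?thesis
    proof cases
      case 1
      then have "([Inl p] @ [Inr q], [Inr p] @ [Inr q]) \<in> word_cong ?X ?R"
        using xy eq by (intro word_cong_append PQ word_cong.refl) auto
      then have "([x, y], [Inr p, Inr q]) \<in> word_cong ?X ?R" using eq by simp
      from word_cong.trans[OF this QQ[of p q]] show ?thesis using 1 C xy eq by (auto simp: X)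
    next
      case 2
      then have "([Inl p] @ [Inr q], [Inl p] @ [Inl q]) \<in> word_cong ?X ?R"
        using xy eq by (intro word_cong_append PQ word_cong.refl word_cong.sym[OF PQ]) auto
      then have "([x, y], [Inl p, Inl q]) \<in> word_cong ?X ?R" using eq by simp
      from word_cong.trans[OF this PP[of p q]] show ?thesis using 2 C xy eq by (auto simp: X)
    qed
  next
    fix p q assume eq: "x = Inr q" "y = Inl p"
    then consider "p \<in> C" | "q \<in> C" using xy by (auto simp: red_def)
    then show ?thesis
    proof cases
      case 1
      then have "([Inr q] @ [Inl p], [Inr q] @ [Inr p]) \<in> word_cong ?X ?R"
        using xy eq by (intro word_cong_append PQ word_cong.refl) auto
      then have "([x, y], [Inr q, Inr p]) \<in> word_cong ?X ?R" using eq by simp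
      from word_cong.trans[OF this QQ[of q p]] show ?thesis using 1 C xy eq by (auto simp: X)
    next
      case 2
      then have "([Inr q] @ [Inl p], [Inl q] @ [Inl p]) \<in> word_cong ?X ?R"
        using xy eq by (intro word_cong_append PQ word_cong.refl word_cong.sym[OF PQ]) auto
      then have "([x, y], [Inl q, Inl p]) \<in> word_cong ?X ?R" using eq by simp
      from word_cong.trans[OF this PP[of q p]] show ?thesis using 2 C xy eq by (auto simp: X)
    qed
  qed
  have B: "?B \<subseteq> carrier G" by auto
  \<comment> \<open>The word acts on the side that its last letter moves. One strict step by a
    letter of P makes everything to its left strict, so only a single letter of Q yields a
    non-strict inclusion, whence the condition on \<open>tl w\<close>.\<close>
  have pingpong: "let Y = word_val ?v w <# (if isl (last w) then ?B else A) in
      (isl (hd w) \<longrightarrow> Y \<subset> A) \<and>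
      (\<not> isl (hd w) \<longrightarrow> Y \<subseteq> ?B \<and> (tl w \<noteq> [] \<longrightarrow> Y \<subset> ?B))"
    if "w \<in> lists ?X" "w \<noteq> []" "successively red w" "\<forall>x\<in>set w. ?v x \<notin> C" for w
    using that
  proof (induction w rule: list.induct)
    case (Cons x w)
    define X0 where "X0 = (if isl (last (x # w)) then ?B else A)"
    have X0: "X0 \<subseteq> carrier G" using A by (auto simp: X0_def)
    have xw: "x \<in> ?X" "w \<in> lists ?X" using Cons.prems(1) by simp_all
    then have x: "?v x \<in> carrier G" and w: "word_val ?v w \<in> carrier G"
      using v word_val_closed[OF v, of w] by blast+
    show ?case
    proof (cases "w = []")
      case True
      then show ?thesis
        using Cons.prems PA QA by (cases x) (auto simp: X)
    next
      case False
      define Y where "Y = word_val ?v w <# X0"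
      have Y: "word_val ?v (x # w) <# X0 = ?v x <# Y" "Y \<subseteq> carrier G"
        using x w X0 by (auto simp: Y_def lcos_m_assoc l_coset_subset_G)
      have IH: "isl (hd w) \<Longrightarrow> Y \<subset> A" "\<not> isl (hd w) \<Longrightarrow> Y \<subseteq> ?B"
        using Cons.IH Cons.prems False
        by (auto simp: Y_def X0_def Let_def successively_Cons)
      show ?thesis
      proof (cases x)
        case (Inl p)
        then have "\<not> isl (hd w)" and p: "p \<in> P - C"
          using Cons.prems False by (auto simp: successively_Cons red_def X)
        then have "p <# Y \<subseteq> p <# ?B" using IH by (intro l_coset_mono)
        also have "\<dots> \<subset> A" using PA p by blast
        finally show ?thesis using Y Inl by (simp add: Let_def X0_def)
      next
        case (Inr q)
        then have "isl (hd w)" and q: "q \<in> Q - C"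
          using Cons.prems False by (auto simp: successively_Cons red_def X)
        then have "q <# Y \<subset> q <# A"
          using IH Y A q Q.mem_carrier by (subst l_coset_less_iff) auto
        also have "\<dots> \<subseteq> ?B" using QA q by blast
        finally show ?thesis using Y Inr by (simp add: Let_def X0_def)
      qed
    qed
  qed simp
  have "\<exists>f\<in>iso (presented ?X ?R) G. \<forall>w\<in>lists ?X. f (word_cong ?X ?R `` {w}) = word_val ?v w"
  proof (rule presented_iso)
    show "?v ` ?X \<subseteq> carrier G" by fact
  next
    show "group (presented ?X ?R)"
      unfolding amalgam_def[symmetric] using P Q by (intro amalgam_group subgroup_imp_group)
  next
    fix u w assume "(u, w) \<in> ?R" "u \<in> lists ?X" "w \<in> lists ?X"
    then show "word_val ?v u = word_val ?v w"
      using C by (auto simp: amalg_rels_def)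
  next
    fix g assume "g \<in> carrier G"
    then have "g \<in> generate G (?v ` ?X)" using gen vX by simp
    moreover have "inv (?v x) \<in> ?v ` ?X" if "x \<in> ?X" for x
      unfolding vX using that by (cases x) (auto simp: X)
    ultimately show "\<exists>w\<in>lists ?X. word_val ?v w = g"
      by (intro generate_word_val[OF v])
  next
    fix w assume w: "w \<in> lists ?X" "word_val ?v w = \<one>"
      and min: "\<And>w'. (w, w') \<in> word_cong ?X ?R \<Longrightarrow> length w \<le> length w'"
    have factor: "length u \<le> length u'"
      if "w = x @ u @ y" "(u, u') \<in> word_cong ?X ?R" for x u y u'
      using min w(1) that by (rule minimal_word_no_factor)
    have succ: "successively red w"
      unfolding successively_conv_nth
    proof (intro allI impI)
      fix i assume i: "Suc i < length w"
      then have eq: "w = take i w @ [w ! i, w ! Suc i] @ drop (Suc (Suc i)) w"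
        by (simp add: Cons_nth_drop_Suc)
      have "w ! i \<in> ?X" "w ! Suc i \<in> ?X" using w i by auto
      then show "red (w ! i) (w ! Suc i)"
        using short[of "w ! i" "w ! Suc i"] factor[OF eq] by force
    qed
    show "w = []"
    \<comment> \<open>This rule separates words with no letter, one letter and more. In a longer
      word every letter belongs to an adjacent pair satisfying \<open>red\<close>, hence lies
      outside C. A lone letter may lie in C, but has value one only as the identity of its
      factor.\<close>
    proof (cases w rule: remdups_adj.cases)
      case (2 x)
      then have "?v x = \<one>" "x \<in> ?X" using w v by auto
      then have "([x], []) \<in> word_cong ?X ?R"
        using P1 Q1 by (cases x) auto
      then show ?thesis using min[of "[]"] 2 by simp
    next
      case (3 x y u)
      have "\<forall>x\<in>set w. ?v x \<notin> C"
      proof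
        fix z assume "z \<in> set w"
        then obtain i where i: "i < length w" "w ! i = z" by (auto simp: in_set_conv_nth)
        show "?v z \<notin> C"
        proof (cases i)
          case 0
          then show ?thesis using succ i 3 by (auto simp: red_def)
        next
          case (Suc j)
          then show ?thesis using succ i by (auto simp: successively_conv_nth red_def)
        qed
      qed
      moreover have "word_val ?v w <# (if isl (last w) then ?B else A) = (if isl (last w) then ?B else A)"
        using w A B by (simp add: lcos_mult_one)
      ultimately show ?thesis
        using pingpong[OF w(1) _ succ] 3 A by (auto simp: Let_def split: if_splits)
    qed auto
  qed
  then show ?thesis
    unfolding is_amalgam_def amalgam_def amalgam_class_def Let_def
    using assms(1-5) by (auto simp: X elim!: bexI[rotated])
qed

text \<open>Ping-pong with four positions: A, the set t A inside it, and their complements. Here t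
  maps A onto t A, and its inverse maps the complement of t A onto that of A. The last three
  hypotheses let a letter of P carry these images into the domain of the next stable letter, unless
  the three letters form a pinch.\<close>

lemma is_hnn_extensionI:
  assumes P: "subgroup P G" and C: "subgroup C G" "C \<subseteq> P" and t: "t \<in> carrier G"
    and tC: "(\<lambda>c. t \<otimes> c \<otimes> inv t) ` C \<subseteq> P"
    and gen: "generate G (insert t P) = carrier G"
    and A: "A \<subseteq> carrier G" "A \<noteq> {}" "A \<noteq> carrier G"
    and CA: "\<And>c. c \<in> C \<Longrightarrow> c <# A = A"
    and PtA: "\<And>p. p \<in> P \<Longrightarrow> p <# (t <# A) \<subset> A"
    and PA: "\<And>p. p \<in> P - C \<Longrightarrow> p <# (carrier G - A) \<subset> A"
    and PtA': "\<And>p. p \<in> P - (\<lambda>c. t \<otimes> c \<otimes> inv t) ` C \<Longrightarrow> p <# (t <# A) \<subset> carrier G - (t <# A)"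
  shows "is_hnn_extension G P C t"
proof -
  let ?P = "G\<lparr>carrier := P\<rparr>" and ?\<theta> = "\<lambda>c. t \<otimes> c \<otimes> inv t"
  let ?X = "hnn_gens ?P" and ?R = "hnn_rels ?P C ?\<theta>"
  let ?v = "case_hnn_gen (\<lambda>p. p) t (inv t) :: 'a hnn_gen \<Rightarrow> 'a"
  let ?B = "carrier G - A" and ?tA = "t <# A" and ?tB = "carrier G - (t <# A)"
  interpret P: subgroup P G by fact
  interpret C: subgroup C G by fact
  have X: "Base p \<in> ?X \<longleftrightarrow> p \<in> P" "Stable \<in> ?X" "Stable_inv \<in> ?X" for p
    by (auto simp: hnn_gens_def)
  have v: "?v ` ?X \<subseteq> carrier G"
    using t by (auto simp: hnn_gens_def)
  have vX: "?v ` ?X = insert t (insert (inv t) P)"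
    by (force simp: hnn_gens_def)
  have relI: "(u, w) \<in> word_cong ?X ?R" if "(u, w) \<in> ?R" "u \<in> lists ?X" "w \<in> lists ?X" for u w
    using that by (rule word_cong_rel)
  have PP: "([Base x, Base y], [Base (x \<otimes> y)]) \<in> word_cong ?X ?R" if "x \<in> P" "y \<in> P" for x y
    using that by (intro relI) (auto simp: X hnn_rels_def)
  have P1: "([Base \<one>], []) \<in> word_cong ?X ?R"
    by (intro relI) (auto simp: X hnn_rels_def)
  have ti: "([Stable, Stable_inv], []) \<in> word_cong ?X ?R"
    by (intro relI) (auto simp: X hnn_rels_def)
  have it: "([Stable_inv, Stable], []) \<in> word_cong ?X ?R"
    by (intro relI) (auto simp: X hnn_rels_def)
  have tci: "([Stable, Base c, Stable_inv], [Base (?\<theta> c)]) \<in> word_cong ?X ?R" if "c \<in> C" for c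
    using that C tC by (intro relI) (auto simp: X hnn_rels_def)
  have ict: "([Stable_inv, Base (?\<theta> c), Stable], [Base c]) \<in> word_cong ?X ?R" if "c \<in> C" for c
  proof -
    have "([Stable_inv] @ [Base (?\<theta> c)] @ [Stable],
        [Stable_inv] @ [Stable, Base c, Stable_inv] @ [Stable]) \<in> word_cong ?X ?R"
      using tci that C by (intro word_cong_context word_cong.sym[OF tci]) (auto simp: X)
    moreover have "([] @ [Stable_inv, Stable] @ [Base c, Stable_inv, Stable],
        [] @ [] @ [Base c, Stable_inv, Stable]) \<in> word_cong ?X ?R"
      using it that C by (intro word_cong_context) (auto simp: X)
    moreover have "([Base c] @ [Stable_inv, Stable] @ [], [Base c] @ [] @ []) \<in> word_cong ?X ?R"
      using it that C by (intro word_cong_context) (auto simp: X)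
    ultimately show ?thesis by simp (blast intro: word_cong.trans)
  qed
  \<comment> \<open>The pinches of Britton's lemma, together with the factors that multiply or
    cancel outright. Each is congruent to a shorter word, so a shortest word contains none.\<close>
  define bad where "bad = {[Base x, Base y] | x y. x \<in> P \<and> y \<in> P} \<union>
    {[Base \<one>], [Stable, Stable_inv], [Stable_inv, Stable]} \<union>
    {[Stable, Base c, Stable_inv] | c. c \<in> C} \<union> {[Stable_inv, Base (?\<theta> c), Stable] | c. c \<in> C}"
  define red where "red = (\<lambda>w. \<forall>x u y. w = x @ u @ y \<longrightarrow> u \<notin> bad)"
  have red_infix: "red w" if "red (x @ w @ y)" for x w y
    unfolding red_def
  proof (intro allI impI)
    fix x' u y' assume "w = x' @ u @ y'"
    then have "x @ w @ y = (x @ x') @ u @ (y' @ y)" by simp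
    then show "u \<notin> bad" using that unfolding red_def by blast
  qed
  have red_Cons: "red w" if "red (x # w)" for x w
    using red_infix[of "[x]" w "[]"] that by simp
  have red_pre: "u \<notin> bad" if "red (u @ w)" for u w
    using that unfolding red_def by (metis append_Nil)
  have red_BB: "\<not> red (Base x # Base y # w)" if "x \<in> P" "y \<in> P" for x y w
    using red_pre[of "[Base x, Base y]" w] that by (auto simp: bad_def)
  have red_ti: "\<not> red (Stable # Stable_inv # w)" "\<not> red (Stable_inv # Stable # w)" for w
    using red_pre[of "[Stable, Stable_inv]" w] red_pre[of "[Stable_inv, Stable]" w]
    by (auto simp: bad_def)
  have red_tci: "p \<notin> C" if "red (Stable # Base p # Stable_inv # w)" for p w
    using red_pre[of "[Stable, Base p, Stable_inv]" w] that by (auto simp: bad_def)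
  have red_ict: "p \<notin> ?\<theta> ` C" if "red (Stable_inv # Base p # Stable # w)" for p w
    using red_pre[of "[Stable_inv, Base p, Stable]" w] that by (auto simp: bad_def)
  have sub: "?B \<subseteq> carrier G" "?tA \<subseteq> carrier G" "?tB \<subseteq> carrier G"
    using A t by (auto dest: l_coset_subset_G[THEN subsetD])
  have tA: "?tA \<subset> A"
    using PtA[of \<one>] sub by (simp add: lcos_mult_one)
  have tB: "t <# ?B = ?tB"
    using t A by (simp add: l_coset_compl)
  \<comment> \<open>The complementary form of \<open>PtA\<close>, obtained from the inverse of
    p.\<close>
  have PB: "p <# ?B \<subset> ?tB" if p: "p \<in> P" for p
  proof -
    have "inv p <# ?tA \<subset> A" using PtA p by simp
    then have "p <# (inv p <# ?tA) \<subset> p <# A"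
      using p sub A l_coset_subset_G by (subst l_coset_less_iff) auto
    then have "?tA \<subset> p <# A" using p sub by (simp add: l_coset_inv_cancel)
    moreover have "p <# A \<subseteq> carrier G" using p A l_coset_subset_G by auto
    ultimately show ?thesis using p A by (auto simp: l_coset_compl)
  qed
  \<comment> \<open>The image of the domain of a stable letter. The value at \<open>Base p\<close>
    is a dummy: in the words considered, a letter of P is always followed by a stable
    letter.\<close>
  define im where "im = (\<lambda>x :: 'a hnn_gen. case x of Stable \<Rightarrow> ?tA | Stable_inv \<Rightarrow> ?B | Base p \<Rightarrow> {})"
  have im_sub: "im x \<subseteq> carrier G" for x
    using sub by (auto simp: im_def split: hnn_gen.splits)
  \<comment> \<open>The start set is the domain of the last letter: A for t, the complement of t A
    for its inverse.\<close>
  have pingpong: "word_val ?v w <# (if last w = Stable then A else ?tB) \<subseteq>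
     (case w of Base p # z # _ \<Rightarrow> p <# im z | z # _ \<Rightarrow> im z)"
    if "w \<in> lists ?X" "w \<noteq> []" "red w" "last w = Stable \<or> last w = Stable_inv" for w
    using that
  proof (induction w rule: list.induct)
    case (Cons x w)
    define X0 where "X0 = (if last (x # w) = Stable then A else ?tB)"
    have X0: "X0 \<subseteq> carrier G" using A sub by (auto simp: X0_def)
    have xw: "x \<in> ?X" "w \<in> lists ?X" using Cons.prems(1) by simp_all
    then have x: "?v x \<in> carrier G" and w: "word_val ?v w \<in> carrier G"
      using v word_val_closed[OF v, of w] by blast+
    have itB: "inv t <# ?tB = ?B"
      using tB sub t by (simp add: l_coset_inv_cancel flip: tB)
    show ?case
    proof (cases "w = []")
      case True
      then show ?thesis
        using Cons.prems t itB by (cases x) (auto simp: im_def)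
    next
      case False
      define Y where "Y = word_val ?v w <# X0"
      have Y: "word_val ?v (x # w) <# X0 = ?v x <# Y" "Y \<subseteq> carrier G"
        using x w X0 by (auto simp: Y_def lcos_m_assoc l_coset_subset_G)
      have IH: "Y \<subseteq> (case w of Base p # z # _ \<Rightarrow> p <# im z | z # _ \<Rightarrow> im z)"
        using Cons.IH Cons.prems False red_Cons
        by (auto simp: Y_def X0_def)
      obtain y w' where w': "w = y # w'" using False by (cases w) auto
      have goal: "?v x <# Y \<subseteq> (case x # w of Base p # z # _ \<Rightarrow> p <# im z | z # _ \<Rightarrow> im z)"
      proof (cases x)
        case (Base p)
        then obtain "y = Stable \<or> y = Stable_inv"
          using Cons.prems red_BB w' by (cases y) (auto simp: X)
        then have "Y \<subseteq> im y" using IH w' by auto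
        then show ?thesis using Base w' by (auto intro!: l_coset_mono)
      next
        case Stable
        have "Y \<subseteq> A"
        proof (cases y)
          case (Base p)
          then obtain z w'' where w'': "w' = z # w''"
            using Cons.prems w' by (cases w') auto
          then have z: "z = Stable \<or> z = Stable_inv" and p: "p \<in> P"
            using Cons.prems red_BB red_Cons w' Base by (cases z; auto simp: X; blast)+
          have "Y \<subseteq> p <# im z" using IH w' w'' Base by simp
          also have "\<dots> \<subseteq> A"
            using z PtA[OF p] PA[of p] p red_tci Cons.prems w' w'' Stable Base
            by (auto simp: im_def)
          finally show ?thesis .
        next
          case Stable
          then show ?thesis using IH w' tA by (auto simp: im_def)
        next
          case Stable_inv
          then show ?thesis using Cons.prems w' Stable red_ti by auto
        qed
        then show ?thesis using Stable by (auto simp: im_def intro!: l_coset_mono)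
      next
        case Stable_inv
        have "Y \<subseteq> ?tB"
        proof (cases y)
          case (Base p)
          then obtain z w'' where w'': "w' = z # w''"
            using Cons.prems w' by (cases w') auto
          then have z: "z = Stable \<or> z = Stable_inv" and p: "p \<in> P"
            using Cons.prems red_BB red_Cons w' Base by (cases z; auto simp: X; blast)+
          have "Y \<subseteq> p <# im z" using IH w' w'' Base by simp
          also have "\<dots> \<subseteq> ?tB"
            using z PB[OF p] PtA'[of p] p red_ict Cons.prems w' w'' Stable_inv Base
            by (auto simp: im_def)
          finally show ?thesis .
        next
          case Stable
          then show ?thesis using Cons.prems w' Stable_inv red_ti by auto
        next
          case Stable_inv
          then show ?thesis using IH w' tA by (auto simp: im_def)
        qed
        then have "inv t <# Y \<subseteq> inv t <# ?tB" by (rule l_coset_mono)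
        then show ?thesis using Stable_inv itB by (auto simp: im_def)
      qed
      then show ?thesis using Y by (simp only: X0_def)
    qed
  qed simp
  \<comment> \<open>Excluding all of P, and not only the value one, also covers words that end in a
    letter \<open>Base p\<close>: such a word \<open>u @ [Base p]\<close> has value one only if u
    has value \<open>inv p\<close>.\<close>
  have not_P: "word_val ?v w \<notin> P"
    if w: "w \<in> lists ?X" "w \<noteq> []" "red w" "last w = Stable \<or> last w = Stable_inv" for w
  proof
    define g where "g = word_val ?v w"
    define X0 where "X0 = (if last w = Stable then A else ?tB)"
    assume "word_val ?v w \<in> P"
    then have g: "g \<in> P" by (simp add: g_def)
    obtain p z where p: "p \<in> P" and z: "z = Stable \<or> z = Stable_inv"
      and le: "g <# X0 \<subseteq> p <# im z"
    proof -
      obtain y w' where w': "w = y # w'" using w by (cases w) auto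
      show thesis
      proof (cases y)
        case (Base p)
        then obtain z w'' where w'': "w' = z # w''"
          using w w' by (cases w') auto
        then have "z = Stable \<or> z = Stable_inv" and "p \<in> P"
          using w red_BB red_Cons w' Base by (cases z; auto simp: X; blast)+
        then show thesis using pingpong[OF w] w' w'' Base
          by (intro that[of p z]) (simp_all add: g_def X0_def)
      next
        case Stable
        then show thesis using pingpong[OF w] w' im_sub
          by (intro that[of \<one> y]) (simp_all add: g_def X0_def lcos_mult_one)
      next
        case Stable_inv
        then show thesis using pingpong[OF w] w' im_sub
          by (intro that[of \<one> y]) (simp_all add: g_def X0_def lcos_mult_one)
      qed
    qed
    \<comment> \<open>Cancelling the leading p leaves a single element q of P that would send a
      domain into an image; the ping-pong hypotheses for q alone refute this.\<close>
    define q where "q = inv p \<otimes> g"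
    have q: "q \<in> P" using p g by (simp add: q_def)
    have X0: "X0 \<subseteq> carrier G" using A sub by (auto simp: X0_def)
    have "inv p <# (g <# X0) \<subseteq> inv p <# (p <# im z)" using le by (rule l_coset_mono)
    then have le: "q <# X0 \<subseteq> im z"
      using p g X0 im_sub by (simp add: q_def l_coset_inv_cancel flip: lcos_m_assoc)
    have qA: "q <# A \<subseteq> carrier G" "q <# ?B = carrier G - (q <# A)" "q <# ?tA \<subseteq> carrier G"
        "q <# ?tB = carrier G - (q <# ?tA)"
      using q A t l_coset_subset_G sub by (auto simp: l_coset_compl)
    have qc: "q \<in> carrier G" using q by simp
    have PB': "q <# ?tA \<subset> A" by (rule PtA[OF q])
    have C: "q <# A = A \<or> q <# ?B \<subset> A" using PA CA q by blast
    have \<theta>: "q <# ?tA = ?tA \<or> q <# ?tA \<subset> ?tB"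
    proof (cases "q \<in> ?\<theta> ` C")
      case True
      then obtain c where c: "c \<in> C" "q = t \<otimes> c \<otimes> inv t" by blast
      then have "q <# ?tA = t <# (c <# (inv t <# (t <# A)))"
        using t A sub by (simp add: lcos_m_assoc m_assoc)
      then show ?thesis using c t A CA by (simp add: l_coset_inv_cancel)
    qed (use PtA' q in blast)
    show False
    proof (cases "last w = Stable")
      case True
      then have "q <# A \<subseteq> ?tA \<or> q <# A \<subseteq> ?B"
        using le z tA by (auto simp: X0_def im_def)
      then show False using C A tA unfolding qA(2) by blast
    next
      case False
      then have "q <# ?tB \<subseteq> ?tA \<or> q <# ?tB \<subseteq> ?B"
        using le z by (auto simp: X0_def im_def)
      then show False
      proof
        assume "q <# ?tB \<subseteq> ?tA"
        then show False using \<theta> A tA unfolding qA(4) by blast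
      next
        assume "q <# ?tB \<subseteq> ?B"
        then show False using PB' A unfolding qA(4) by blast
      qed
    qed
  qed
  have "\<exists>f\<in>iso (presented ?X ?R) G. \<forall>w\<in>lists ?X. f (word_cong ?X ?R `` {w}) = word_val ?v w"
  proof (rule presented_iso)
    show "?v ` ?X \<subseteq> carrier G" by fact
  next
    show "group (presented ?X ?R)"
      unfolding hnn_extension_def[symmetric] using P by (intro hnn_extension_group subgroup_imp_group)
  next
    fix u w assume "(u, w) \<in> ?R" "u \<in> lists ?X" "w \<in> lists ?X"
    then show "word_val ?v u = word_val ?v w"
      using C t by (auto simp: hnn_rels_def m_assoc)
  next
    fix g assume "g \<in> carrier G"
    then have "g \<in> generate G (?v ` ?X)"
      using gen vX mono_generate[of "insert t P" "insert t (insert (inv t) P)"] by auto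
    moreover have "inv (?v x) \<in> ?v ` ?X" if "x \<in> ?X" for x
      unfolding vX using that t by (cases x) (auto simp: X)
    ultimately show "\<exists>w\<in>lists ?X. word_val ?v w = g"
      by (intro generate_word_val[OF v])
  next
    fix w assume w: "w \<in> lists ?X" "word_val ?v w = \<one>"
      and min: "\<And>w'. (w, w') \<in> word_cong ?X ?R \<Longrightarrow> length w \<le> length w'"
    have factor: "length u \<le> length u'"
      if "w = x @ u @ y" "(u, u') \<in> word_cong ?X ?R" for x u y u'
      using min w(1) that by (rule minimal_word_no_factor)
    have red: "red w"
      unfolding red_def
    proof (intro allI impI notI)
      fix x u y assume eq: "w = x @ u @ y" and "u \<in> bad"
      then consider  a b where "a \<in> P" "b \<in> P" "u = [Base a, Base b]"
        |  "u = [Base \<one>]" |  "u = [Stable, Stable_inv]" |  "u = [Stable_inv, Stable]"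
        |  c where "c \<in> C" "u = [Stable, Base c, Stable_inv]"
        |  c where "c \<in> C" "u = [Stable_inv, Base (?\<theta> c), Stable]"
        unfolding bad_def by blast
      then show False
      proof cases
        case (1 a b)
        then show False using factor[OF eq, of "[Base (a \<otimes> b)]"] PP by simp
      next
        case (5 c)
        then show False using factor[OF eq, of "[Base (?\<theta> c)]"] tci by simp
      next
        case (6 c)
        then show False using factor[OF eq, of "[Base c]"] ict by simp
      qed (use factor[OF eq, of "[]"] P1 ti it in simp_all)
    qed
    show "w = []"
    proof (cases w rule: rev_cases)
      case (snoc u x)
      have u: "u \<in> lists ?X" "x \<in> ?X" using w snoc by auto
      have "False"
      proof (cases "x = Stable \<or> x = Stable_inv")
        case True
        then show False using not_P[of w] w red snoc by simp
      next
        case False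
        then obtain p where p: "x = Base p" "p \<in> P" using u by (cases x) (auto simp: X)
        have "word_val ?v u \<otimes> p = \<one>" "word_val ?v u \<in> carrier G"
          using w snoc p u word_val_closed[OF v] by (auto simp: word_val_append[OF v])
        then have val: "word_val ?v u = inv p" using p inv_equality[of "word_val ?v u" p] by simp
        show False
        proof (cases u rule: rev_cases)
          case Nil
          then have "w = [] @ [Base \<one>] @ []" using \<open>word_val ?v u \<otimes> p = \<one>\<close> snoc p by simp
          then show False using red unfolding red_def bad_def by blast
        next
          case (snoc u' y)
          have "y = Stable \<or> y = Stable_inv"
          proof (cases y)
            case (Base p')
            then have "w = u' @ [Base p', Base p] @ []" "p' \<in> P"
              using \<open>w = u @ [x]\<close> snoc p u by (auto simp: X)
            then show ?thesis using red p unfolding red_def bad_def by blast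
          qed auto
          moreover have "red u" using red_infix[of "[]" u "[x]"] red \<open>w = u @ [x]\<close> by simp
          ultimately show False using not_P[of u] u snoc val p by simp
        qed
      qed
      then show ?thesis ..
    qed simp
  qed
  then show ?thesis
    unfolding is_hnn_extension_def hnn_extension_def hnn_class_def Let_def
    using assms(1-5) by (auto simp: X elim!: bexI[rotated])
qed

end

section \<open>Splittings from nested half-spaces\<close>

text \<open>\<open>finite_separating\<close> makes intervals of half-spaces finite and so provides
  paths between edges. The last two assumptions exclude amalgams in which a factor equals the edge
  stabilizer.\<close>

locale nested_half_space = group G for G (structure) +
  fixes A
  assumes A: "A \<subseteq> carrier G"
    and A_proper: "A \<noteq> {}" "A \<noteq> carrier G"
    and nested: "g \<in> carrier G \<Longrightarrow>
      A \<subseteq> g <# A \<or> g <# A \<subseteq> A \<or> A \<inter> (g <# A) = {} \<or> A \<union> (g <# A) = carrier G"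
    and finite_separating: "\<lbrakk>x \<in> carrier G; y \<in> carrier G\<rbrakk> \<Longrightarrow>
      finite {Z \<in> (\<lambda>g. g <# A) ` carrier G. x \<in> Z \<and> y \<notin> Z}"
    and no_disjoint: "\<exists>g\<in>carrier G. g <# A \<noteq> A \<and> (g <# A) \<inter> A \<noteq> {}"
    and no_covering: "\<exists>g\<in>carrier G. g <# A \<noteq> A \<and> (g <# A) \<union> A \<noteq> carrier G"
begin

abbreviation compl where "compl X \<equiv> carrier G - X"

definition half_spaces where
  "half_spaces = (\<lambda>g. g <# A) ` carrier G \<union> (\<lambda>g. g <# compl A) ` carrier G"

lemma half_spaces_subset: "X \<in> half_spaces \<Longrightarrow> X \<subseteq> carrier G"
  using l_coset_subset_G[OF A] l_coset_subset_G[of "compl A"] unfolding half_spaces_def by blast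

lemma A_half_space [simp]: "A \<in> half_spaces" "compl A \<in> half_spaces"
proof -
  have "A = \<one> <# A" "compl A = \<one> <# compl A"
    using A by (simp_all add: lcos_mult_one)
  then show "A \<in> half_spaces" "compl A \<in> half_spaces"
    unfolding half_spaces_def by blast+
qed

lemma compl_half_space [simp]: 
  assumes "X \<in> half_spaces"
  shows "compl X \<in> half_spaces"
proof -
  have "compl (compl A) = A" using A by blast
  with assms show ?thesis
    using A l_coset_compl[of _ A] l_coset_compl[of _ "compl A"] unfolding half_spaces_def by auto
qed

lemma l_coset_half_space [simp]:
  "X \<in> half_spaces \<Longrightarrow> g \<in> carrier G \<Longrightarrow> g <# X \<in> half_spaces"
  using A unfolding half_spaces_def by (auto simp: lcos_m_assoc)

lemma half_space_nontrivial:
  assumes "X \<in> half_spaces"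
  shows "X \<noteq> {}" "X \<noteq> carrier G"
proof -
  have *: "X \<noteq> {}" if "X \<in> half_spaces" for X
  proof -
    from that consider g where "X = g <# A" | g where "X = g <# compl A"
      unfolding half_spaces_def by blast
    then show ?thesis using A A_proper by cases (auto simp: l_coset_def)
  qed
  show "X \<noteq> {}" "X \<noteq> carrier G" using *[of X] *[of "compl X"] assms by auto
qed

lemma half_spaces_nested:
  assumes X: "X \<in> half_spaces" and Y: "Y \<in> half_spaces"
  shows "X \<subseteq> Y \<or> Y \<subseteq> X \<or> X \<inter> Y = {} \<or> X \<union> Y = carrier G"
proof -
  let ?N = "\<lambda>X Y. X \<subseteq> Y \<or> Y \<subseteq> X \<or> X \<inter> Y = {} \<or> X \<union> Y = carrier G"
  have translates: "?N (g <# A) (h <# A)" if g: "g \<in> carrier G" "h \<in> carrier G" for g h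
  proof -
    let ?h = "inv g \<otimes> h"
    have hc: "?h \<in> carrier G" using g by simp
    have h: "g <# (?h <# A) = h <# A"
      using that A by (simp add: lcos_m_assoc m_assoc[symmetric])
    have sub: "?h <# A \<subseteq> carrier G" using that A l_coset_subset_G by auto
    have int: "g <# (A \<inter> (?h <# A)) = (g <# A) \<inter> (h <# A)" 
      and un: "g <# (A \<union> (?h <# A)) = (g <# A) \<union> (h <# A)" 
      unfolding h[symmetric] using that A sub
      by (auto simp: mem_l_coset le_infI1)
    have full: "g <# carrier G = carrier G" and empty: "g <# {} = {}"
      using g l_coset_compl[of g "{}"] by (auto simp: l_coset_def)
    consider "A \<subseteq> ?h <# A" | "?h <# A \<subseteq> A" | "A \<inter> (?h <# A) = {}"
      | "A \<union> (?h <# A) = carrier G"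
      using nested[OF hc] by blast
    then show ?thesis
    proof cases
      case 1
      then show ?thesis using l_coset_mono[of A "?h <# A" g] h by simp
    next
      case 2
      then show ?thesis using l_coset_mono[of "?h <# A" A g] h by simp
    next
      case 3
      then show ?thesis using int empty by simp
    next
      case 4
      then show ?thesis using un full by simp
    qed
  qed
  have *: "\<exists>g\<in>carrier G. X = g <# A \<or> X = compl (g <# A)" if "X \<in> half_spaces" for X
    using that A by (auto simp: half_spaces_def l_coset_compl)
  obtain g X' where g: "g \<in> carrier G" "X' = g <# A" "X = X' \<or> X = compl X'"
    using *[OF X] by auto
  obtain h Y' where h: "h \<in> carrier G" "Y' = h <# A" "Y = Y' \<or> Y = compl Y'"
    using *[OF Y] by auto
  have "X' \<subseteq> carrier G" "Y' \<subseteq> carrier G" using g h A l_coset_subset_G by auto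
  moreover have "?N X' Y'" using translates[OF g(1) h(1)] g h by simp
  ultimately show ?thesis using g(3) h(3) by (elim disjE) blast+
qed

text \<open>Choose x in X and y outside Y. A half-space in between contains x and misses y, so it is
  a translate of A separating x from y, or the complement of one separating y from x.\<close>

lemma finite_interval:
  assumes X: "X \<in> half_spaces" and Y: "Y \<in> half_spaces"
  shows "finite {Z \<in> half_spaces. X \<subseteq> Z \<and> Z \<subseteq> Y}"
proof -
  obtain x y where x: "x \<in> X" "x \<in> carrier G" and y: "y \<in> carrier G" "y \<notin> Y"
    using half_space_nontrivial X Y half_spaces_subset by blast
  let ?F = "\<lambda>x y. {Z \<in> (\<lambda>g. g <# A) ` carrier G. x \<in> Z \<and> y \<notin> Z}"
  have "{Z \<in> half_spaces. X \<subseteq> Z \<and> Z \<subseteq> Y} \<subseteq> ?F x y \<union> compl ` ?F y x"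
    using x y A by (auto simp: half_spaces_def l_coset_compl)
  moreover have "finite (?F x y \<union> compl ` ?F y x)"
    using finite_separating x y by blast
  ultimately show ?thesis by (rule finite_subset)
qed

text \<open>Half-spaces are the oriented edges of a tree; two of them are adjacent if they have the same
  initial vertex.\<close>

definition adj where
  "adj X Y \<longleftrightarrow> X = Y \<or> compl X \<subset> Y \<and> \<not> (\<exists>Z\<in>half_spaces. compl X \<subset> Z \<and> Z \<subset> Y)"

lemma adj_refl [simp]: "adj X X"
  by (simp add: adj_def)

lemma adjD:
  assumes "adj X Y" "X \<noteq> Y"
  shows "compl X \<subset> Y" "Z \<in> half_spaces \<Longrightarrow> \<not> (compl X \<subset> Z \<and> Z \<subset> Y)"
  using assms by (auto simp: adj_def)

lemma adj_sym:
  assumes "X \<in> half_spaces" "Y \<in> half_spaces" "adj X Y"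
  shows "adj Y X"
proof (cases "X = Y")
  case False
  then have XY: "compl X \<subset> Y" "\<And>Z. Z \<in> half_spaces \<Longrightarrow> \<not> (compl X \<subset> Z \<and> Z \<subset> Y)"
    using assms adjD by simp_all
  have sub: "X \<subseteq> carrier G" "Y \<subseteq> carrier G" using assms half_spaces_subset by blast+
  have "\<not> (compl Y \<subset> Z \<and> Z \<subset> X)" if Z: "Z \<in> half_spaces" for Z
    using XY(2)[of "compl Z"] Z sub half_spaces_subset[OF Z] by (auto simp: psubset_eq)
  moreover have "compl Y \<subset> X" using XY(1) sub by auto
  ultimately show ?thesis unfolding adj_def by blast
qed simp

text \<open>If X, Y, W are distinct, then X and W both lie minimally above \<open>compl Y\<close>.
  So neither contains the other and they meet, and nestedness leaves only that they cover G. A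
  half-space strictly between \<open>compl X\<close> and W is excluded by comparing it with
  Y.\<close>

lemma adj_trans:
  assumes X: "X \<in> half_spaces" and Y: "Y \<in> half_spaces" and W: "W \<in> half_spaces"
    and "adj X Y" "adj Y W"
  shows "adj X W"
proof (cases "X = Y \<or> Y = W \<or> X = W")
  case False
  have sub: "X \<subseteq> carrier G" "Y \<subseteq> carrier G" "W \<subseteq> carrier G"
    using assms half_spaces_subset by blast+
  note ne = half_space_nontrivial[OF X] half_space_nontrivial[OF Y] half_space_nontrivial[OF W]
  have neq: "X \<noteq> Y" "Y \<noteq> X" "Y \<noteq> W" using False by auto
  note XY = adjD[OF assms(4) neq(1)] and YX = adjD[OF adj_sym[OF X Y assms(4)] neq(2)]
    and YW = adjD[OF assms(5) neq(3)]
  have "\<not> X \<subset> W" using YW(2)[OF X] YX(1) by blast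
  moreover have "\<not> W \<subset> X" using YX(2)[OF W] YW(1) by blast
  moreover have "X \<inter> W \<noteq> {}" using YX(1) YW(1) ne sub by blast
  ultimately have XW: "X \<union> W = carrier G"
    using half_spaces_nested[OF X W] False by blast
  have "compl X \<noteq> W"
    using XY(1) YW(1) ne sub by blast
  then have "compl X \<subset> W" using XW by blast
  moreover have "\<not> (compl X \<subset> Z \<and> Z \<subset> W)" if Z: "Z \<in> half_spaces" for Z
  proof
    assume *: "compl X \<subset> Z \<and> Z \<subset> W"
    have ZY: "Z \<subset> W" "compl X \<subset> Z" "Z \<subseteq> carrier G" using * half_spaces_subset[OF Z] by auto
    have W_full: "\<not> Y \<subseteq> W"
      using YW(1) ne sub by blast
    consider "Z \<subseteq> Y" | "Y \<subseteq> Z" | "Z \<inter> Y = {}" | "Z \<union> Y = carrier G"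
      using half_spaces_nested[OF Z Y] by blast
    then show False
    proof cases
      case 1
      then show ?thesis using XY(2)[OF Z] ZY W_full by blast
    next
      case 2
      then show ?thesis using ZY W_full by blast
    next
      case 3
      then show ?thesis using ZY XY(1) ne sub by blast
    next
      case 4
      then have "compl Y \<subseteq> Z" by blast
      then have "Z = compl Y" using YW(2)[OF Z] ZY by blast
      then show ?thesis using ZY XY(1) ne sub by blast
    qed
  qed
  ultimately show ?thesis unfolding adj_def by blast
qed (use assms in auto)

lemma adj_l_coset:
  assumes X: "X \<in> half_spaces" and Y: "Y \<in> half_spaces" and g: "g \<in> carrier G" and "adj X Y"
  shows "adj (g <# X) (g <# Y)"
proof (cases "X = Y")
  case False
  then have XY: "compl X \<subset> Y" "\<And>Z. Z \<in> half_spaces \<Longrightarrow> \<not> (compl X \<subset> Z \<and> Z \<subset> Y)"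
    using assms adjD by simp_all
  note sub = X[THEN half_spaces_subset] Y[THEN half_spaces_subset]
  have c: "g <# compl X = compl (g <# X)" using g sub by (simp add: l_coset_compl)
  have "compl (g <# X) \<subset> g <# Y"
    unfolding c[symmetric] using XY(1) g sub by (subst l_coset_less_iff) auto
  moreover have "\<not> (compl (g <# X) \<subset> Z \<and> Z \<subset> g <# Y)" if Z: "Z \<in> half_spaces" for Z
  proof -
    let ?Z = "inv g <# Z"
    have "Z = g <# ?Z" "?Z \<in> half_spaces"
      using Z g half_spaces_subset by (simp_all add: l_coset_inv_cancel)
    then show ?thesis
      using XY(2)[of ?Z] g sub half_spaces_subset[of ?Z] unfolding c[symmetric]
      by (metis Diff_subset l_coset_less_iff)
  qed
  ultimately show ?thesis unfolding adj_def by blast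
qed simp

text \<open>A maximal element of a finite interval; in the tree, the edge next to Y on the path from
  X to Y.\<close>

lemma ex_adj:
  assumes X: "X \<in> half_spaces" and Y: "Y \<in> half_spaces" and "X \<subset> Y"
  shows "\<exists>Z\<in>half_spaces. X \<subseteq> Z \<and> Z \<subset> Y \<and> adj (compl Z) Y"
proof -
  let ?S = "{Z \<in> half_spaces. X \<subseteq> Z \<and> Z \<subset> Y}"
  have "finite ?S" by (rule finite_subset[OF _ finite_interval[OF X Y]]) auto
  moreover have "?S \<noteq> {}" using assms by auto
  ultimately have "\<exists>Z\<in>?S. \<forall>W\<in>?S. Z \<subseteq> W \<longrightarrow> Z = W" by (rule finite_has_maximal)
  then obtain Z where Z: "Z \<in> ?S" and max: "\<forall>W\<in>?S. Z \<subseteq> W \<longrightarrow> Z = W" by (rule bexE)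
  have "compl (compl Z) = Z" using Z half_spaces_subset by blast
  moreover have "\<not> (Z \<subset> W \<and> W \<subset> Y)" if "W \<in> half_spaces" for W
    using max Z that by blast
  ultimately have "adj (compl Z) Y" using Z by (simp add: adj_def)
  then show ?thesis using Z by blast
qed

text \<open>Connectedness of the tree: a subgroup that reaches all neighbours of A and of its
  complement reaches every edge. One step from B towards Z leads to some W = k B'. Translating back
  by k puts B' in the place of B and shrinks the interval, since the one from Z to W misses
  B.\<close>

lemma half_spaces_from_subgroup:
  assumes K: "subgroup K G"
    and loc: "\<And>Y. Y \<in> half_spaces \<Longrightarrow> adj Y A \<or> adj Y (compl A) \<Longrightarrow>
      \<exists>k\<in>K. Y = k <# A \<or> Y = k <# compl A"
    and Z: "Z \<in> half_spaces"
  shows "\<exists>k\<in>K. Z = k <# A \<or> Z = k <# compl A"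
proof -
  interpret K: subgroup K G by fact
  define I where "I = (\<lambda>X Y. {Z \<in> half_spaces. X \<subseteq> Z \<and> Z \<subseteq> Y})"
  have flip: "compl (k <# A) = k <# compl A" "compl (k <# compl A) = k <# A" if "k \<in> K" for k
    using A that l_coset_subset_G[OF A, of k] by (auto simp: l_coset_compl)
  have below: "\<exists>k\<in>K. Z = k <# A \<or> Z = k <# compl A"
    if "Z \<in> half_spaces" "B = A \<or> B = compl A" "Z \<subseteq> B" for Z B
    using that
  proof (induction "card (I Z B)" arbitrary: Z B rule: less_induct)
    case less
    have B: "B \<in> half_spaces" "B \<subseteq> carrier G" using less.prems A by auto
    show ?case
    proof (cases "Z = B")
      case True
      then show ?thesis
        using less.prems B by (intro bexI[of _ \<one>]) (auto simp: lcos_mult_one)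
    next
      case False
      then obtain W where W: "W \<in> half_spaces" "Z \<subseteq> W" "W \<subset> B" "adj (compl W) B"
        using ex_adj[of Z B] less.prems B by blast
      then obtain k where k: "k \<in> K" "compl W = k <# A \<or> compl W = k <# compl A"
        using loc[of "compl W"] less.prems by auto
      moreover have "compl (compl W) = W" using W half_spaces_subset by blast
      ultimately have "W = k <# A \<or> W = k <# compl A" using flip by metis
      then obtain B' where B': "B' = A \<or> B' = compl A" "W = k <# B'" by blast
      let ?Z = "inv k <# Z"
      have kG: "k \<in> carrier G" "B' \<subseteq> carrier G" "Z \<subseteq> carrier G" "?Z \<in> half_spaces"
        using k(1) B'(1) A less.prems(1) half_spaces_subset[OF less.prems(1)] by auto
      have ZB': "?Z \<subseteq> B'"
        using l_coset_mono[OF W(2), of "inv k"] kG B' by (simp add: l_coset_inv_cancel)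
      have "I ?Z B' \<subseteq> (\<lambda>V. inv k <# V) ` I Z W"
      proof
        fix V assume V: "V \<in> I ?Z B'"
        then have "V \<in> half_spaces" "V \<subseteq> carrier G" by (auto simp: I_def dest: half_spaces_subset)
        then have "inv k <# (k <# V) = V" "k <# V \<in> half_spaces"
          using kG by (auto simp: l_coset_inv_cancel)
        moreover have "Z \<subseteq> k <# V" "k <# V \<subseteq> W"
          using l_coset_mono[of ?Z V k] l_coset_mono[of V B' k] V kG B'
          by (auto simp: I_def l_coset_inv_cancel)
        ultimately show "V \<in> (\<lambda>V. inv k <# V) ` I Z W" by (force simp: I_def)
      qed
      moreover have fin: "finite (I Z W)" "finite (I Z B)"
        using finite_interval less.prems W B by (auto simp: I_def)
      ultimately have "card (I ?Z B') \<le> card (I Z W)"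
        by (meson card_image_le card_mono finite_imageI le_trans)
      also have "\<dots> < card (I Z B)"
      proof (rule psubset_card_mono[OF fin(2)])
        have "B \<in> I Z B" "B \<notin> I Z W" "I Z W \<subseteq> I Z B"
          using B less.prems W by (auto simp: I_def)
        then show "I Z W \<subset> I Z B" by blast
      qed
      finally obtain k' where k': "k' \<in> K" "?Z = k' <# A \<or> ?Z = k' <# compl A"
        using less.hyps[OF _ kG(4) B'(1) ZB'] by blast
      have "Z = k <# ?Z" using kG by (simp add: l_coset_inv_cancel)
      then have "Z = (k \<otimes> k') <# A \<or> Z = (k \<otimes> k') <# compl A"
        using k' k A by (auto simp: lcos_m_assoc)
      then show ?thesis using k k' by blast
    qed
  qed
  have Zc: "compl (compl Z) = Z" "Z \<subseteq> carrier G" using Z half_spaces_subset by blast+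
  \<comment> \<open>By nestedness, Z or its complement lies below A or \<open>compl A\<close>, and
    complementing does not affect the claim.\<close>
  have "Z \<subseteq> A \<or> Z \<subseteq> compl A \<or> compl Z \<subseteq> A \<or> compl Z \<subseteq> compl A"
    using half_spaces_nested[OF Z A_half_space(1)] Zc A by blast
  then consider "\<exists>k\<in>K. Z = k <# A \<or> Z = k <# compl A"
    | "\<exists>k\<in>K. compl Z = k <# A \<or> compl Z = k <# compl A"
    using below[OF Z] below[of "compl Z"] Z by (metis compl_half_space)
  then show ?thesis using Zc flip by cases metis+
qed

text \<open>A Frattini argument: if some k in K takes A or \<open>compl A\<close> to g A, then
  \<open>inv k \<otimes> g\<close> sends A to A or to \<open>compl A\<close>, and therefore lies in
  K.\<close>

lemma subgroup_eq_carrier: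
  assumes K: "subgroup K G"
    and loc: "\<And>Y. Y \<in> half_spaces \<Longrightarrow> adj Y A \<or> adj Y (compl A) \<Longrightarrow>
      \<exists>k\<in>K. Y = k <# A \<or> Y = k <# compl A"
    and stab: "\<And>g. g \<in> carrier G \<Longrightarrow> g <# A = A \<or> g <# A = compl A \<Longrightarrow> g \<in> K"
  shows "K = carrier G"
proof -
  interpret K: subgroup K G by fact
  have "g \<in> K" if g: "g \<in> carrier G" for g
  proof -
    obtain k where k: "k \<in> K" "g <# A = k <# A \<or> g <# A = k <# compl A"
      using half_spaces_from_subgroup[OF K loc, of "g <# A"] g by auto
    then have "inv k <# (g <# A) = A \<or> inv k <# (g <# A) = compl A"
      using A by (auto simp: l_coset_inv_cancel)
    then have "inv k \<otimes> g \<in> K" using stab[of "inv k \<otimes> g"] k g A by (simp add: lcos_m_assoc)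
    then have "k \<otimes> (inv k \<otimes> g) \<in> K" using k by blast
    then show ?thesis using k g by (simp add: m_assoc[symmetric])
  qed
  then show ?thesis using K.subset by blast
qed

section \<open>Stabilizers and the three types of quotient graph\<close>

definition edge_stab where "edge_stab = {g \<in> carrier G. g <# A = A}"

text \<open>\<open>adj\<close> is a G-invariant equivalence relation on half-spaces whose classes
  are the vertices, so this is the stabilizer of the initial vertex of X.\<close>

definition vertex_stab where "vertex_stab X = {g \<in> carrier G. adj (g <# X) X}"

lemma edge_stab_subgroup: "subgroup edge_stab G"
proof (rule subgroupI)
  show "edge_stab \<noteq> {}" using A by (auto simp: edge_stab_def lcos_mult_one)
  show "inv g \<in> edge_stab" if "g \<in> edge_stab" for g
    using that A l_coset_inv_cancel(1)[of g A] by (simp add: edge_stab_def)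
  show "g \<otimes> h \<in> edge_stab" if "g \<in> edge_stab" "h \<in> edge_stab" for g h
    using that A lcos_m_assoc[of A g h] by (simp add: edge_stab_def)
qed (auto simp: edge_stab_def)

lemma vertex_stab_subgroup:
  assumes X: "X \<in> half_spaces"
  shows "subgroup (vertex_stab X) G"
proof (rule subgroupI)
  have sub: "X \<subseteq> carrier G" using X by (rule half_spaces_subset)
  show "vertex_stab X \<noteq> {}" using sub by (auto simp: vertex_stab_def lcos_mult_one)
  show "inv g \<in> vertex_stab X" if "g \<in> vertex_stab X" for g
  proof -
    have g: "g \<in> carrier G" "adj (g <# X) X" using that by (auto simp: vertex_stab_def)
    then have "adj (inv g <# (g <# X)) (inv g <# X)" using X by - (rule adj_l_coset; auto)
    then have "adj (inv g <# X) X"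
      using g X sub by - (rule adj_sym; auto simp: l_coset_inv_cancel)
    then show ?thesis using g by (simp add: vertex_stab_def)
  qed
  show "g \<otimes> h \<in> vertex_stab X" if "g \<in> vertex_stab X" "h \<in> vertex_stab X" for g h
  proof -
    have "adj (g <# (h <# X)) (g <# X)"
      using that X by - (rule adj_l_coset; auto simp: vertex_stab_def)
    then have "adj (g <# (h <# X)) X"
      using that X by - (rule adj_trans[of _ "g <# X" X]; auto simp: vertex_stab_def)
    then show ?thesis using that sub by (simp add: vertex_stab_def lcos_m_assoc)
  qed
qed (auto simp: vertex_stab_def)

lemma edge_stab_le: "edge_stab \<subseteq> vertex_stab A" "edge_stab \<subseteq> vertex_stab (compl A)"
  using A by (auto simp: edge_stab_def vertex_stab_def l_coset_compl)

lemma vertex_stab_coset: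
  assumes "p \<in> vertex_stab A - edge_stab"
  shows "p <# compl A \<subset> A"
  using assms A unfolding vertex_stab_def edge_stab_def adj_def by (auto simp: l_coset_compl)

text \<open>Since s reverses the edge A, the edge is subdivided at its midpoint. Q is the stabilizer
  of the midpoint and contains \<open>edge_stab\<close> with index two; the other factor is the
  stabilizer of the initial vertex.\<close>

lemma split_with_inversion:
  assumes s: "s \<in> carrier G" "s <# A = compl A"
  shows "splits_nontrivially_over G edge_stab"
proof -
  define Q where "Q = {g \<in> carrier G. g <# A = A \<or> g <# A = compl A}"
  have AA: "compl (compl A) = A" using A by blast
  have gc: "g <# compl A = compl (g <# A)" if "g \<in> carrier G" for g
    using that A by (simp add: l_coset_compl)
  have Q: "subgroup Q G"
  proof (rule subgroupI)
    show "Q \<noteq> {}" using s by (auto simp: Q_def)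
    show "inv g \<in> Q" if "g \<in> Q" for g
    proof -
      have g: "g \<in> carrier G" using that by (simp add: Q_def)
      have "g <# A = A \<or> g <# A = compl A" using that by (simp add: Q_def)
      then have "inv g <# A = A \<or> inv g <# A = compl A"
      proof
        assume "g <# A = A"
        then show ?thesis using l_coset_inv_cancel(1)[OF g A] by simp
      next
        assume "g <# A = compl A"
        then have "g <# compl A = A" using g AA by (simp add: gc)
        then show ?thesis using l_coset_inv_cancel(1)[OF g, of "compl A"] by simp
      qed
      then show ?thesis using g by (simp add: Q_def)
    qed
    show "g \<otimes> h \<in> Q" if "g \<in> Q" "h \<in> Q" for g h
    proof -
      have gh: "g \<in> carrier G" "h \<in> carrier G" using that by (auto simp: Q_def)
      then have "(g \<otimes> h) <# A = g <# (h <# A)" using A by (simp add: lcos_m_assoc)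
      then show ?thesis using that gh AA by (auto simp: Q_def gc)
    qed
  qed (auto simp: Q_def)
  let ?P = "vertex_stab A" and ?K = "generate G (vertex_stab A \<union> Q)"
  have P: "subgroup ?P G" by (rule vertex_stab_subgroup) simp
  have QG: "Q \<subseteq> carrier G" "?P \<subseteq> carrier G" by (auto simp: Q_def vertex_stab_def)
  have K: "subgroup ?K G" using QG by (intro generate_is_subgroup) auto
  have PQ: "?P \<subseteq> ?K" "Q \<subseteq> ?K" by (auto intro: generate.incl)
  \<comment> \<open>Thanks to s, every half-space is a translate of A itself; one adjacent to A is
    then a translate by an element of \<open>vertex_stab A\<close>.\<close>
  have nearA: "\<exists>k\<in>?K. Y = k <# A" if Y: "Y \<in> half_spaces" "adj Y A" for Y
  proof -
    from Y obtain h where h: "h \<in> carrier G" "Y = h <# A \<or> Y = h <# compl A"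
      unfolding half_spaces_def by blast
    then have "Y = h <# A \<or> Y = (h \<otimes> s) <# A"
      using s A by (auto simp flip: lcos_m_assoc)
    then obtain k where "k \<in> carrier G" "Y = k <# A" using h s by blast
    then show ?thesis using Y PQ by (auto simp: vertex_stab_def)
  qed
  have K_eq: "?K = carrier G"
  proof (rule subgroup_eq_carrier[OF K])
    fix Y assume Y: "Y \<in> half_spaces" "adj Y A \<or> adj Y (compl A)"
    show "\<exists>k\<in>?K. Y = k <# A \<or> Y = k <# compl A"
    proof (cases "adj Y A")
      case False
      then have "adj (inv s <# Y) (inv s <# compl A)"
        using Y s(1) by - (rule adj_l_coset; auto)
      moreover have "inv s <# compl A = A"
        using l_coset_inv_cancel(1)[OF s(1) A] s(2) by simp
      ultimately obtain k where k: "k \<in> ?K" "inv s <# Y = k <# A"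
        using nearA[of "inv s <# Y"] Y s(1) by auto
      have "Y = s <# (inv s <# Y)"
        using Y s half_spaces_subset by (simp add: l_coset_inv_cancel)
      also have "\<dots> = (s \<otimes> k) <# A"
        using k s A K by (simp add: lcos_m_assoc subgroup.mem_carrier)
      finally have Y_eq: "Y = (s \<otimes> k) <# A" .
      have "s \<in> Q" using s by (simp add: Q_def)
      then have "s \<otimes> k \<in> ?K" using subgroup.m_closed[OF K _ k(1)] PQ(2) by blast
      with Y_eq show ?thesis by blast
    qed (use Y nearA in blast)
  qed (use PQ in \<open>auto simp: Q_def\<close>)
  have Q_props: "edge_stab \<subseteq> Q" "s \<in> Q" "s \<notin> edge_stab"
    using s A by (auto simp: Q_def edge_stab_def)
  have QA: "q <# A \<subseteq> compl A" if "q \<in> Q - edge_stab" for q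
    using that by (auto simp: Q_def edge_stab_def)
  have "is_amalgam G ?P Q edge_stab"
    by (rule is_amalgamI[OF P Q edge_stab_subgroup edge_stab_le(1) Q_props(1) K_eq A A_proper
          vertex_stab_coset QA])
  moreover have "?P \<noteq> edge_stab"
  proof
    assume "?P = edge_stab"
    then have "?P \<union> Q = Q" using Q_props by blast
    then have "Q = carrier G" using K_eq generate_subgroup_incl[OF _ Q, of "?P \<union> Q"] QG by simp
    then show False using no_disjoint unfolding Q_def by blast
  qed
  ultimately show ?thesis
    unfolding splits_nontrivially_over_def using Q_props by blast
qed

text \<open>The quotient graph is one edge with two distinct vertices. Complementing reverses an
  edge, so \<open>vertex_stab (compl A)\<close> is the stabilizer of the terminal vertex of
  A.\<close>

lemma split_two_vertex_orbits:
  assumes no_inv: "\<And>g. g \<in> carrier G \<Longrightarrow> g <# A \<noteq> compl A"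
    and no_adj: "\<And>g. g \<in> carrier G \<Longrightarrow> \<not> adj (g <# compl A) A"
  shows "splits_nontrivially_over G edge_stab"
proof -
  let ?P = "vertex_stab A" and ?Q = "vertex_stab (compl A)"
  let ?K = "generate G (?P \<union> ?Q)"
  have P: "subgroup ?P G" and Q: "subgroup ?Q G" by (intro vertex_stab_subgroup; simp)+
  have PQG: "?P \<union> ?Q \<subseteq> carrier G" by (auto simp: vertex_stab_def)
  have K: "subgroup ?K G" using PQG by (intro generate_is_subgroup) auto
  have PQ: "?P \<subseteq> ?K" "?Q \<subseteq> ?K" by (auto intro: generate.incl)
  have gc: "g <# compl A = compl (g <# A)" if "g \<in> carrier G" for g
    using that A by (simp add: l_coset_compl)
  have K_eq: "?K = carrier G"
  proof (rule subgroup_eq_carrier[OF K])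
    fix Y assume Y: "Y \<in> half_spaces" "adj Y A \<or> adj Y (compl A)"
    then obtain h where h: "h \<in> carrier G" "Y = h <# A \<or> Y = h <# compl A"
      unfolding half_spaces_def by blast
    have "\<not> adj (h <# A) (compl A)"
    proof
      assume "adj (h <# A) (compl A)"
      then have "adj (inv h <# (h <# A)) (inv h <# compl A)"
        using h by - (rule adj_l_coset; auto)
      then have "adj (inv h <# compl A) A"
        using h A by - (rule adj_sym; auto simp: l_coset_inv_cancel)
      then show False using no_adj h by blast
    qed
    then show "\<exists>k\<in>?K. Y = k <# A \<or> Y = k <# compl A"
      using Y h no_adj PQ by (auto simp: vertex_stab_def)
  next
    fix g assume "g \<in> carrier G" "g <# A = A \<or> g <# A = compl A"
    then show "g \<in> ?K" using no_inv edge_stab_le PQ by (auto simp: edge_stab_def)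
  qed
  have QA: "q <# A \<subseteq> compl A" if q: "q \<in> ?Q - edge_stab" for q
  proof -
    have "q \<in> carrier G" using q by (auto simp: vertex_stab_def)
    moreover from this have "compl (compl (q <# A)) = q <# A"
      using l_coset_subset_G[OF A] by blast
    moreover have "q <# compl A \<noteq> compl A"
      using q A \<open>q \<in> carrier G\<close> \<open>compl (compl (q <# A)) = q <# A\<close>
      by (auto simp: edge_stab_def gc)
    ultimately show ?thesis using q by (auto simp: vertex_stab_def adj_def gc)
  qed
  have am: "is_amalgam G ?P ?Q edge_stab"
    by (rule is_amalgamI[OF P Q edge_stab_subgroup edge_stab_le K_eq A A_proper
          vertex_stab_coset QA])
  moreover have "?P \<noteq> edge_stab"
  proof
    assume "?P = edge_stab"
    then have "?P \<union> ?Q = ?Q" using edge_stab_le by blast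
    then have "?Q = carrier G" using K_eq generate_subgroup_incl[OF _ Q, of "?P \<union> ?Q"] PQG by auto
    then have "g <# A = A \<or> (g <# A) \<inter> A = {}" if "g \<in> carrier G" for g
      using QA[of g] that by (auto simp: edge_stab_def)
    then show False using no_disjoint by blast
  qed
  moreover have "?Q \<noteq> edge_stab"
  proof
    assume "?Q = edge_stab"
    then have "?P \<union> ?Q = ?P" using edge_stab_le by blast
    then have "?P = carrier G" using K_eq generate_subgroup_incl[OF _ P, of "?P \<union> ?Q"] PQG by auto
    then have "g <# A = A \<or> (g <# A) \<union> A = carrier G" if "g \<in> carrier G" for g
      using vertex_stab_coset[of g] that l_coset_subset_G[OF A that] A
      by (auto simp: edge_stab_def gc)
    then show False using no_covering by blast
  qed
  ultimately show ?thesis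
    unfolding splits_nontrivially_over_def by blast
qed

text \<open>The element t carries the terminal vertex of A to its initial vertex, so the quotient
  graph is a loop and t becomes the stable letter.\<close>

lemma split_one_vertex_orbit:
  assumes no_inv: "\<And>g. g \<in> carrier G \<Longrightarrow> g <# A \<noteq> compl A"
    and t: "t \<in> carrier G" and adj_t: "adj (t <# compl A) A"
  shows "splits_nontrivially_over G edge_stab"
proof -
  let ?P = "vertex_stab A" and ?K = "generate G (insert t (vertex_stab A))"
  have P: "subgroup ?P G" by (intro vertex_stab_subgroup; simp)
  have PG: "insert t ?P \<subseteq> carrier G" using t by (auto simp: vertex_stab_def)
  have K: "subgroup ?K G" using PG by (intro generate_is_subgroup) auto
  have PK: "?P \<subseteq> ?K" "t \<in> ?K" by (auto intro: generate.incl)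
  have gc: "g <# compl A = compl (g <# A)" if "g \<in> carrier G" for g
    using that A by (simp add: l_coset_compl)
  \<comment> \<open>Both h and t carry the terminal vertex of A to its initial vertex, so this
    product fixes the latter. It puts h into the generated group, and conjugates of
    \<open>edge_stab\<close> by t into the vertex stabilizer.\<close>
  have PI: "h \<otimes> inv t \<in> ?P" if h: "h \<in> carrier G" "adj (h <# compl A) A" for h
  proof -
    have "adj ((h \<otimes> inv t) <# (t <# compl A)) ((h \<otimes> inv t) <# A)"
      using h t adj_t by - (rule adj_l_coset; auto)
    moreover have "(h \<otimes> inv t) <# (t <# compl A) = h <# compl A"
      using h t A by (simp add: lcos_m_assoc m_assoc)
    ultimately have "adj ((h \<otimes> inv t) <# A) (h <# compl A)"
      using h t by - (rule adj_sym; auto)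
    then have "adj ((h \<otimes> inv t) <# A) A"
      using h t by - (rule adj_trans[of _ "h <# compl A" A]; auto)
    then show ?thesis using h t by (simp add: vertex_stab_def)
  qed
  have nearA: "\<exists>k\<in>?K. Y = k <# A \<or> Y = k <# compl A" if Y: "Y \<in> half_spaces" "adj Y A" for Y
  proof -
    from Y obtain h where h: "h \<in> carrier G" "Y = h <# A \<or> Y = h <# compl A"
      unfolding half_spaces_def by blast
    moreover have "h \<in> ?K" if "Y = h <# compl A"
    proof -
      have "h \<otimes> inv t \<in> ?K" using PI[of h] h that Y PK by simp blast
      then have "(h \<otimes> inv t) \<otimes> t \<in> ?K" using PK(2) subgroup.m_closed[OF K] by blast
      then show ?thesis using h t by (simp add: m_assoc)
    qed
    ultimately show ?thesis using Y PK by (auto simp: vertex_stab_def)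
  qed
  have K_eq: "?K = carrier G"
  proof (rule subgroup_eq_carrier[OF K])
    fix Y assume Y: "Y \<in> half_spaces" "adj Y A \<or> adj Y (compl A)"
    show "\<exists>k\<in>?K. Y = k <# A \<or> Y = k <# compl A"
    proof (cases "adj Y A")
      case False
      then have "adj (t <# Y) (t <# compl A)"
        using Y t by - (rule adj_l_coset; auto)
      then have "adj (t <# Y) A"
        using Y t adj_t by - (rule adj_trans[of _ "t <# compl A" A]; auto)
      then obtain k where k: "k \<in> ?K" "t <# Y = k <# A \<or> t <# Y = k <# compl A"
        using nearA[of "t <# Y"] Y t by auto
      have kG: "k \<in> carrier G" using k K subgroup.mem_carrier by metis
      have "Y = inv t <# (t <# Y)"
        using Y t half_spaces_subset by (simp add: l_coset_inv_cancel)
      then have "Y = (inv t \<otimes> k) <# A \<or> Y = (inv t \<otimes> k) <# compl A"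
        using k t A kG by (auto simp flip: lcos_m_assoc)
      moreover have "inv t \<otimes> k \<in> ?K"
        using k PK K by (simp add: subgroup.m_closed subgroup.m_inv_closed)
      ultimately show ?thesis by blast
    qed (use Y nearA in blast)
  next
    fix g assume "g \<in> carrier G" "g <# A = A \<or> g <# A = compl A"
    then show "g \<in> ?K" using no_inv edge_stab_le PK by (auto simp: edge_stab_def)
  qed
  have tA: "t <# A \<subseteq> carrier G" using l_coset_subset_G[OF A t] .
  have ptA: "adj (p <# (t <# compl A)) A" if p: "p \<in> ?P" for p
  proof -
    have pG: "p \<in> carrier G" using p by (simp add: vertex_stab_def)
    then have "adj (p <# (t <# compl A)) (p <# A)" using t adj_t by - (rule adj_l_coset; auto)
    then show ?thesis
      using p pG t by - (rule adj_trans[of _ "p <# A" A]; auto simp: vertex_stab_def)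
  qed
  have flip: "p <# (t <# compl A) = compl (p <# (t <# A))"
    "compl (p <# (t <# compl A)) = p <# (t <# A)" if "p \<in> ?P" for p
    using that t A tA l_coset_subset_G[OF tA, of p]
    by (auto simp: gc l_coset_compl vertex_stab_def)
  have "is_hnn_extension G ?P edge_stab t"
  proof (rule is_hnn_extensionI)
    show "(\<lambda>c. t \<otimes> c \<otimes> inv t) ` edge_stab \<subseteq> ?P"
    proof
      fix h assume "h \<in> (\<lambda>c. t \<otimes> c \<otimes> inv t) ` edge_stab"
      then obtain c where c: "c \<in> carrier G" "c <# A = A" "h = t \<otimes> c \<otimes> inv t"
        by (auto simp: edge_stab_def)
      then have "(t \<otimes> c) <# compl A = t <# compl A"
        using t A by (simp add: gc flip: lcos_m_assoc)
      then show "h \<in> ?P" using PI[of "t \<otimes> c"] c t adj_t by simp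
    qed
    show "p <# (t <# A) \<subset> A" if p: "p \<in> ?P" for p
    proof -
      have pG: "p \<in> carrier G" using p by (simp add: vertex_stab_def)
      have "(p \<otimes> t) <# A \<noteq> compl A" using no_inv[of "p \<otimes> t"] pG t by blast
      then have "p <# (t <# A) \<noteq> compl A" using pG t A by (simp add: lcos_m_assoc)
      then have "p <# (t <# compl A) \<noteq> A"
        using flip[OF p] by metis
      then show ?thesis using ptA[OF p] flip[OF p] by (simp add: adj_def)
    qed
    show "p <# (t <# A) \<subset> compl (t <# A)"
      if p: "p \<in> ?P - (\<lambda>c. t \<otimes> c \<otimes> inv t) ` edge_stab" for p
    proof -
      have pP: "p \<in> ?P" and pG: "p \<in> carrier G" using p by (auto simp: vertex_stab_def)
      \<comment> \<open>The conjugate of \<open>edge_stab\<close> by t is the stabilizer of t A. For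
        p outside it, the edges p t \<open>compl A\<close> and t \<open>compl A\<close> are distinct
        and share their initial vertex, and adjacency turns into the strict inclusion.\<close>
      have "p <# (t <# A) \<noteq> t <# A"
      proof
        assume *: "p <# (t <# A) = t <# A"
        have "(inv t \<otimes> p \<otimes> t) <# A = inv t <# (p <# (t <# A))"
          using t pG A tA by (simp add: lcos_m_assoc m_assoc)
        then have "inv t \<otimes> p \<otimes> t \<in> edge_stab"
          using * t pG A by (simp add: edge_stab_def l_coset_inv_cancel)
        moreover have "p = t \<otimes> (inv t \<otimes> p \<otimes> t) \<otimes> inv t"
          using t pG by (simp add: m_assoc) (simp flip: m_assoc)
        ultimately show False using p by blast
      qed
      then have "p <# (t <# compl A) \<noteq> t <# compl A"
        using flip[OF pP] gc[OF t] tA by (metis double_diff order_refl)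
      moreover have "adj (p <# (t <# compl A)) (t <# compl A)"
        using ptA[OF pP] t pG adj_t adj_sym[of "t <# compl A" A]
        by - (rule adj_trans[of _ A "t <# compl A"]; auto)
      ultimately show ?thesis using flip[OF pP] gc[OF t] by (simp add: adj_def)
    qed
    show "c <# A = A" if "c \<in> edge_stab" for c using that by (simp add: edge_stab_def)
  qed (fact P edge_stab_subgroup edge_stab_le t K_eq A A_proper vertex_stab_coset)+
  then show ?thesis unfolding splits_nontrivially_over_def by blast
qed

lemma splits_over_edge_stab: "splits_nontrivially_over G edge_stab"
  using split_with_inversion split_two_vertex_orbits split_one_vertex_orbit by blast

end

section \<open>Almost invariant sets over varying subgroups\<close>

context group
begin

lemma coset_finite_iff:
  assumes "subgroup L G"
  shows "coset_finite G L X \<longleftrightarrow> (\<exists>F. finite F \<and> F \<subseteq> carrier G \<and> X \<subseteq> (\<Union>f\<in>F. L #> f))"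
proof
  assume "coset_finite G L X"
  then obtain F where F: "finite F" "F \<subseteq> (\<lambda>f. L #> f) ` carrier G" "X \<subseteq> \<Union>F"
    unfolding coset_finite_def RCOSETS_def by auto
  then obtain F' where "F' \<subseteq> carrier G" "finite F'" "F = (\<lambda>f. L #> f) ` F'"
    using finite_subset_image[OF F(1,2)] by blast
  with F show "\<exists>F. finite F \<and> F \<subseteq> carrier G \<and> X \<subseteq> (\<Union>f\<in>F. L #> f)" by blast
next
  assume "\<exists>F. finite F \<and> F \<subseteq> carrier G \<and> X \<subseteq> (\<Union>f\<in>F. L #> f)"
  then obtain F where "finite F" "F \<subseteq> carrier G" "X \<subseteq> (\<Union>f\<in>F. L #> f)" by blast
  then show "coset_finite G L X"
    unfolding coset_finite_def RCOSETS_def by (intro exI[of _ "(\<lambda>f. L #> f) ` F"]) auto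
qed

lemma coset_finite_mono: "coset_finite G L X \<Longrightarrow> Y \<subseteq> X \<Longrightarrow> coset_finite G L Y"
  unfolding coset_finite_def by blast

lemma coset_finite_empty [simp]: "coset_finite G L {}"
  unfolding coset_finite_def by blast

lemma coset_finite_Un: 
  assumes "coset_finite G L X" "coset_finite G L Y"
  shows "coset_finite G L (X \<union> Y)"
proof -
  obtain F F' where "finite F" "F \<subseteq> rcosets L" "X \<subseteq> \<Union>F" "finite F'" "F' \<subseteq> rcosets L" "Y \<subseteq> \<Union>F'"
    using assms unfolding coset_finite_def by blast
  then show ?thesis unfolding coset_finite_def by (intro exI[of _ "F \<union> F'"]) auto
qed

lemma coset_finite_UN:
  "finite I \<Longrightarrow> (\<And>i. i \<in> I \<Longrightarrow> coset_finite G L (X i)) \<Longrightarrow> coset_finite G L (\<Union>i\<in>I. X i)"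
  by (induction I rule: finite_induct) (auto intro: coset_finite_Un)

lemma coset_finite_coset: "f \<in> carrier G \<Longrightarrow> coset_finite G L (L #> f)"
  unfolding coset_finite_def RCOSETS_def by (intro exI[of _ "{L #> f}"]) auto

lemma mem_r_coset:
  "f \<in> carrier G \<Longrightarrow> L \<subseteq> carrier G \<Longrightarrow> y \<in> L #> f \<longleftrightarrow> y \<in> carrier G \<and> y \<otimes> inv f \<in> L"
  by (force simp: r_coset_def m_assoc)

lemma coset_finite_r_coset:
  assumes L: "subgroup L G" and X: "coset_finite G L X" and s: "s \<in> carrier G"
  shows "coset_finite G L (X #> s)"
proof -
  obtain F where F: "finite F" "F \<subseteq> carrier G" "X \<subseteq> (\<Union>f\<in>F. L #> f)"
    using X by (auto simp: coset_finite_iff[OF L])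
  have "X #> s \<subseteq> (\<Union>f\<in>F. L #> (f \<otimes> s))"
  proof
    fix y assume "y \<in> X #> s"
    then obtain x where "x \<in> X" "y = x \<otimes> s" by (auto simp: r_coset_def)
    moreover from this obtain f l where "f \<in> F" "l \<in> L" "x = l \<otimes> f"
      using F(3) by (auto simp: r_coset_def)
    ultimately show "y \<in> (\<Union>f\<in>F. L #> (f \<otimes> s))"
      using F(2) s subgroup.mem_carrier[OF L] by (auto simp: r_coset_def m_assoc subset_iff)
  qed
  moreover have "coset_finite G L (\<Union>f\<in>F. L #> (f \<otimes> s))"
    using F s by (intro coset_finite_UN coset_finite_coset) auto
  ultimately show ?thesis by (rule coset_finite_mono[rotated])
qed

text \<open>\<open>coset_finite G M L\<close> for subgroups expresses that the intersection of L and
  M has finite index in L.\<close>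

lemma coset_finite_trans:
  assumes L: "subgroup L G" and M: "subgroup M G"
    and "coset_finite G L X" and "coset_finite G M L"
  shows "coset_finite G M X"
proof -
  obtain F where F: "finite F" "F \<subseteq> carrier G" "X \<subseteq> (\<Union>f\<in>F. L #> f)"
    using assms(3) by (auto simp: coset_finite_iff[OF L])
  moreover have "coset_finite G M (\<Union>f\<in>F. L #> f)"
    using F assms(4) M by (intro coset_finite_UN coset_finite_r_coset) auto
  ultimately show ?thesis by (blast intro: coset_finite_mono)
qed

lemma coset_finite_self: "subgroup L G \<Longrightarrow> coset_finite G L L"
  using coset_finite_coset[of \<one> L] by (simp add: coset_mult_one subgroup.subset)

lemma coset_finite_supergroup:
  assumes "subgroup L G" "subgroup M G" "M \<subseteq> L" "coset_finite G M X"
  shows "coset_finite G L X"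
  by (rule coset_finite_trans[OF assms(2,1,4) coset_finite_mono[OF coset_finite_self[OF assms(1)] assms(3)]])

text \<open>Two cosets \<open>L f\<close> and \<open>M f'\<close> are disjoint or intersect in a coset of \<open>L \<inter> M\<close>.\<close>

lemma coset_finite_Int:
  assumes L: "subgroup L G" and M: "subgroup M G"
    and X: "coset_finite G L X" and Y: "coset_finite G M Y"
  shows "coset_finite G (L \<inter> M) (X \<inter> Y)"
proof -
  interpret L: subgroup L G by fact
  interpret M: subgroup M G by fact
  have cosets: "coset_finite G (L \<inter> M) ((L #> f) \<inter> (M #> f'))"
    if f: "f \<in> carrier G" "f' \<in> carrier G" for f f'
  proof (cases "(L #> f) \<inter> (M #> f') = {}")
    case False
    then obtain u where u: "u \<in> L #> f" "u \<in> M #> f'" by blast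
    then have uG: "u \<in> carrier G" using f L.subset by (simp add: mem_r_coset)
    have "(L #> f) \<inter> (M #> f') = (L #> u) \<inter> (M #> u)"
      using repr_independence[OF u(1) f(1) L] repr_independence[OF u(2) f(2) M] by simp
    also have "\<dots> \<subseteq> (L \<inter> M) #> u"
      using uG L.subset M.subset by (auto simp: mem_r_coset le_infI1)
    finally show ?thesis by (rule coset_finite_mono[OF coset_finite_coset[OF uG]])
  qed simp
  obtain F F' where F: "finite F" "F \<subseteq> carrier G" "X \<subseteq> (\<Union>f\<in>F. L #> f)"
    "finite F'" "F' \<subseteq> carrier G" "Y \<subseteq> (\<Union>f\<in>F'. M #> f)"
    using X Y coset_finite_iff L M by metis
  have "X \<inter> Y \<subseteq> (\<Union>f\<in>F. \<Union>f'\<in>F'. (L #> f) \<inter> (M #> f'))"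
    using F(3,6) by blast
  moreover have "coset_finite G (L \<inter> M) (\<Union>f\<in>F. \<Union>f'\<in>F'. (L #> f) \<inter> (M #> f'))"
    using F by (intro coset_finite_UN cosets) auto
  ultimately show ?thesis by (rule coset_finite_mono[rotated])
qed

section \<open>Conjugates and one-sided coboundaries\<close>

definition conj_by where "conj_by g L = g <# L #> inv g"

lemma mem_conj_by:
  assumes "g \<in> carrier G" "L \<subseteq> carrier G"
  shows "y \<in> conj_by g L \<longleftrightarrow> y \<in> carrier G \<and> inv g \<otimes> y \<otimes> g \<in> L"
  using assms l_coset_subset_G[OF assms(2,1)]
  by (auto simp: conj_by_def mem_r_coset mem_l_coset m_assoc)

lemma conj_by_subgroup:
  assumes g: "g \<in> carrier G" and L: "subgroup L G"
  shows "subgroup (conj_by g L) G"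
proof -
  interpret L: subgroup L G by fact
  show ?thesis
  proof (rule subgroupI)
    show "conj_by g L \<subseteq> carrier G" using g L.subset by (auto simp: mem_conj_by)
    have "\<one> \<in> conj_by g L" using g L.subset by (simp add: mem_conj_by)
    then show "conj_by g L \<noteq> {}" by blast
    show "inv y \<in> conj_by g L" if "y \<in> conj_by g L" for y
    proof -
      have y: "y \<in> carrier G" "inv g \<otimes> y \<otimes> g \<in> L" using that g L.subset by (auto simp: mem_conj_by)
      have "inv (inv g \<otimes> y \<otimes> g) = inv g \<otimes> inv y \<otimes> g"
        using y g by (simp add: inv_mult_group m_assoc)
      then show ?thesis using y g L.subset L.m_inv_closed[OF y(2)] by (simp add: mem_conj_by)
    qed
    show "y \<otimes> z \<in> conj_by g L" if "y \<in> conj_by g L" "z \<in> conj_by g L" for y z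
    proof -
      have y: "y \<in> carrier G" "inv g \<otimes> y \<otimes> g \<in> L" and z: "z \<in> carrier G" "inv g \<otimes> z \<otimes> g \<in> L"
        using that g L.subset by (auto simp: mem_conj_by)
      have "(inv g \<otimes> y \<otimes> g) \<otimes> (inv g \<otimes> z \<otimes> g) = inv g \<otimes> y \<otimes> (g \<otimes> inv g) \<otimes> z \<otimes> g"
        using y(1) z(1) g by (simp only: m_assoc inv_closed m_closed)
      also have "\<dots> = inv g \<otimes> (y \<otimes> z) \<otimes> g"
        using y(1) z(1) g by (simp add: m_assoc)
      finally show ?thesis
        using y(1) z(1) g L.subset L.m_closed[OF y(2) z(2)] by (simp add: mem_conj_by)
    qed
  qed
qed

lemma l_coset_r_coset_conj_by:
  assumes "g \<in> carrier G" "f \<in> carrier G" "L \<subseteq> carrier G"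
  shows "g <# (L #> f) = conj_by g L #> (g \<otimes> f)"
proof -
  have "conj_by g L \<subseteq> carrier G" using assms by (auto simp: mem_conj_by)
  moreover have "L #> f \<subseteq> carrier G" using assms by (simp add: r_coset_subset_G)
  ultimately show ?thesis
    using assms by (auto simp: mem_l_coset mem_r_coset mem_conj_by m_assoc inv_mult_group)
qed

lemma coset_finite_l_coset:
  assumes L: "subgroup L G" and X: "coset_finite G L X" and g: "g \<in> carrier G"
  shows "coset_finite G (conj_by g L) (g <# X)"
proof -
  obtain F where F: "finite F" "F \<subseteq> carrier G" "X \<subseteq> (\<Union>f\<in>F. L #> f)"
    using X by (auto simp: coset_finite_iff[OF L])
  have "g <# X \<subseteq> g <# (\<Union>f\<in>F. L #> f)" using F by (intro l_coset_mono)
  also have "\<dots> = (\<Union>f\<in>F. g <# (L #> f))" by (auto simp: l_coset_def)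
  also have "\<dots> = (\<Union>f\<in>F. conj_by g L #> (g \<otimes> f))"
    using F g L by (intro SUP_cong refl l_coset_r_coset_conj_by) (auto simp: subgroup.subset)
  finally show ?thesis
    using F g by (elim coset_finite_mono[rotated]) (intro coset_finite_UN coset_finite_coset, auto)
qed

text \<open>One half of the symmetric difference suffices: A minus A s is the coboundary for
  \<open>inv s\<close>, and A s minus A is the right translate by s of the coboundary for s.\<close>

lemma almost_invariant_iff:
  assumes L: "subgroup L G" and A: "A \<subseteq> carrier G"
  shows "almost_invariant G L A \<longleftrightarrow> (\<forall>s\<in>carrier G. coset_finite G L {y \<in> A. y \<otimes> s \<notin> A})"
proof
  assume *: "almost_invariant G L A"
  show "\<forall>s\<in>carrier G. coset_finite G L {y \<in> A. y \<otimes> s \<notin> A}"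
  proof
    fix s assume s: "s \<in> carrier G"
    then have "coset_finite G L (sym_diff A (A #> inv s))"
      using * unfolding almost_invariant_def by blast
    then show "coset_finite G L {y \<in> A. y \<otimes> s \<notin> A}"
      by (rule coset_finite_mono) (use s A in \<open>auto simp: mem_r_coset\<close>)
  qed
next
  assume *: "\<forall>s\<in>carrier G. coset_finite G L {y \<in> A. y \<otimes> s \<notin> A}"
  show "almost_invariant G L A"
    unfolding almost_invariant_def
  proof
    fix s assume s: "s \<in> carrier G"
    have "coset_finite G L ({y \<in> A. y \<otimes> inv s \<notin> A} \<union> ({y \<in> A. y \<otimes> s \<notin> A} #> s))"
      using * s L by (intro coset_finite_Un coset_finite_r_coset) auto
    then show "coset_finite G L (sym_diff A (A #> s))"
    proof (rule coset_finite_mono)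
      show "sym_diff A (A #> s) \<subseteq> {y \<in> A. y \<otimes> inv s \<notin> A} \<union> ({y \<in> A. y \<otimes> s \<notin> A} #> s)"
      proof -
        have "{y \<in> A. y \<otimes> s \<notin> A} \<subseteq> carrier G" using A by blast
        then show ?thesis using A s by (auto simp: mem_r_coset m_assoc)
      qed
    qed
  qed
qed

text \<open>The right-hand group \<open>H\<close> is kept apart from \<open>L\<close>: all sets of the argument are right
  invariant under the original \<open>H\<close>, while \<open>L\<close> varies.\<close>

definition bi_almost_invariant where
  "bi_almost_invariant H L A \<longleftrightarrow> A \<subseteq> carrier G \<and> (\<forall>l\<in>L. \<forall>a\<in>A. l \<otimes> a \<in> A) \<and>
    (\<forall>h\<in>H. \<forall>a\<in>A. a \<otimes> h \<in> A) \<and> (\<forall>s\<in>carrier G. coset_finite G L {y \<in> A. y \<otimes> s \<notin> A})"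

lemma bi_almost_invariantD:
  assumes "bi_almost_invariant H L A"
  shows "A \<subseteq> carrier G" "\<And>l a. l \<in> L \<Longrightarrow> a \<in> A \<Longrightarrow> l \<otimes> a \<in> A"
    "\<And>h a. h \<in> H \<Longrightarrow> a \<in> A \<Longrightarrow> a \<otimes> h \<in> A"
    "\<And>s. s \<in> carrier G \<Longrightarrow> coset_finite G L {y \<in> A. y \<otimes> s \<notin> A}"
  using assms unfolding bi_almost_invariant_def by blast+

lemma bi_almost_invariant_carrier:
  assumes "subgroup L G" "subgroup H G"
  shows "bi_almost_invariant H L (carrier G)"
proof -
  have "coset_finite G L {y \<in> carrier G. y \<otimes> s \<notin> carrier G}" if "s \<in> carrier G" for s
    by (rule coset_finite_mono[OF coset_finite_empty]) (use that in auto)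
  then show ?thesis
    using assms unfolding bi_almost_invariant_def by (auto simp: subgroup.mem_carrier)
qed

lemma bi_almost_invariant_compl:
  assumes L: "subgroup L G" and H: "subgroup H G" and A: "bi_almost_invariant H L A"
  shows "bi_almost_invariant H L (carrier G - A)"
proof -
  note A = bi_almost_invariantD[OF A]
  interpret L: subgroup L G by fact
  interpret H: subgroup H G by fact
  have "l \<otimes> a \<notin> A" if "l \<in> L" "a \<in> carrier G - A" for l a
  proof
    assume "l \<otimes> a \<in> A"
    then have "inv l \<otimes> (l \<otimes> a) \<in> A" using that A by blast
    then show False using that by (simp add: m_assoc[symmetric])
  qed
  moreover have "a \<otimes> h \<notin> A" if "h \<in> H" "a \<in> carrier G - A" for h a
  proof
    assume "a \<otimes> h \<in> A"
    then have "(a \<otimes> h) \<otimes> inv h \<in> A" using that A by blast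
    then show False using that by (simp add: m_assoc)
  qed
  moreover have "coset_finite G L {y \<in> carrier G - A. y \<otimes> s \<notin> carrier G - A}"
    if s: "s \<in> carrier G" for s
  proof -
    have "coset_finite G L ({y \<in> A. y \<otimes> inv s \<notin> A} #> inv s)"
      using s A L by (intro coset_finite_r_coset) auto
    moreover have "{y \<in> carrier G - A. y \<otimes> s \<notin> carrier G - A} \<subseteq> {y \<in> A. y \<otimes> inv s \<notin> A} #> inv s"
    proof
      fix y assume "y \<in> {y \<in> carrier G - A. y \<otimes> s \<notin> carrier G - A}"
      then have "y \<otimes> s \<in> {y \<in> A. y \<otimes> inv s \<notin> A}" "y = (y \<otimes> s) \<otimes> inv s"
        using s by (auto simp: m_assoc)
      then show "y \<in> {y \<in> A. y \<otimes> inv s \<notin> A} #> inv s" by (force simp: r_coset_def)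
    qed
    ultimately show ?thesis by (rule coset_finite_mono)
  qed
  ultimately show ?thesis unfolding bi_almost_invariant_def by auto
qed

lemma bi_almost_invariant_Int:
  assumes "bi_almost_invariant H L A" "bi_almost_invariant H L B"
  shows "bi_almost_invariant H L (A \<inter> B)"
proof -
  have "coset_finite G L {y \<in> A \<inter> B. y \<otimes> s \<notin> A \<inter> B}" if "s \<in> carrier G" for s
    using coset_finite_Un[OF bi_almost_invariantD(4)[OF assms(1) that] bi_almost_invariantD(4)[OF assms(2) that]]
    by (rule coset_finite_mono) auto
  then show ?thesis using assms unfolding bi_almost_invariant_def by auto
qed

lemma bi_almost_invariant_l_coset:
  assumes L: "subgroup L G" and H: "subgroup H G" and g: "g \<in> carrier G" 
    and A: "bi_almost_invariant H L A"
  shows "bi_almost_invariant H (conj_by g L) (g <# A)"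
proof -
  note A = bi_almost_invariantD[OF A]
  interpret L: subgroup L G by fact
  interpret H: subgroup H G by fact
  have gA: "g <# A \<subseteq> carrier G" using A g by (simp add: l_coset_subset_G)
  have left: "l \<otimes> a \<in> g <# A" if l: "l \<in> conj_by g L" and a: "a \<in> g <# A" for l a
  proof -
    have "l \<in> carrier G" "inv g \<otimes> l \<otimes> g \<in> L" "a \<in> carrier G" "inv g \<otimes> a \<in> A"
      using l a g A(1) L.subset by (auto simp: mem_conj_by mem_l_coset)
    moreover from this have "(inv g \<otimes> l \<otimes> g) \<otimes> (inv g \<otimes> a) \<in> A" using A by blast
    moreover have "(inv g \<otimes> l \<otimes> g) \<otimes> (inv g \<otimes> a) = inv g \<otimes> l \<otimes> (g \<otimes> inv g) \<otimes> a"
      using \<open>l \<in> carrier G\<close> \<open>a \<in> carrier G\<close> g by (simp only: m_assoc inv_closed m_closed)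
    ultimately show ?thesis using g A(1) by (simp add: mem_l_coset m_assoc)
  qed
  have right: "a \<otimes> h \<in> g <# A" if "h \<in> H" "a \<in> g <# A" for h a
    using that A(1) A(3)[of h "inv g \<otimes> a"] g by (auto simp: mem_l_coset m_assoc)
  have "coset_finite G (conj_by g L) {y \<in> g <# A. y \<otimes> s \<notin> g <# A}" if s: "s \<in> carrier G" for s
  proof -
    have "{y \<in> g <# A. y \<otimes> s \<notin> g <# A} = g <# {y \<in> A. y \<otimes> s \<notin> A}"
      using g s A(1) by (auto simp: mem_l_coset m_assoc subset_iff)
    then show ?thesis using coset_finite_l_coset[OF L A(4)[OF s] g] by simp
  qed
  with left right gA show ?thesis unfolding bi_almost_invariant_def by blast
qed

lemma bi_almost_invariant_finite_index:
  assumes "subgroup L G" "subgroup M G" "M \<subseteq> L" "coset_finite G M L"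
    and "bi_almost_invariant H L A"
  shows "bi_almost_invariant H M A"
  using assms coset_finite_trans[OF assms(1,2) _ assms(4)] unfolding bi_almost_invariant_def by blast

text \<open>If \<open>y = l f\<close> lies in \<open>Z\<close>, then \<open>y (f\<^sup>-\<^sup>1 a) = l a\<close> does not.\<close>

lemma coset_finite_Int_almost_invariant:
  assumes L: "subgroup L G" and M: "subgroup M G" and Z: "bi_almost_invariant H M Z"
    and a: "a \<in> carrier G" "(L #> a) \<inter> Z = {}" and X: "coset_finite G L X"
  shows "coset_finite G (L \<inter> M) (X \<inter> Z)"
proof -
  interpret L: subgroup L G by fact
  obtain F where F: "finite F" "F \<subseteq> carrier G" "X \<subseteq> (\<Union>f\<in>F. L #> f)"
    using X by (auto simp: coset_finite_iff[OF L])
  have "coset_finite G (L \<inter> M) ((L #> f) \<inter> Z)" if "f \<in> F" for f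
  proof -
    have f: "f \<in> carrier G" using that F by blast
    have "y \<otimes> (inv f \<otimes> a) \<notin> Z" if y: "y \<in> L #> f" for y
    proof -
      have "y \<in> carrier G" "y \<otimes> inv f \<in> L" using y f L.subset by (auto simp: mem_r_coset)
      then have "y \<otimes> (inv f \<otimes> a) \<in> L #> a"
        using f a L.subset by (force simp: r_coset_def m_assoc)
      then show ?thesis using a by blast
    qed
    then have "(L #> f) \<inter> Z \<subseteq> (L #> f) \<inter> {y \<in> Z. y \<otimes> (inv f \<otimes> a) \<notin> Z}" by blast
    moreover have "coset_finite G (L \<inter> M) ((L #> f) \<inter> {y \<in> Z. y \<otimes> (inv f \<otimes> a) \<notin> Z})"
      using f a bi_almost_invariantD(4)[OF Z] by (intro coset_finite_Int L M coset_finite_coset) auto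
    ultimately show ?thesis by (rule coset_finite_mono[rotated])
  qed
  then have "coset_finite G (L \<inter> M) (\<Union>f\<in>F. (L #> f) \<inter> Z)"
    using F by (intro coset_finite_UN) auto
  then show ?thesis by (rule coset_finite_mono) (use F in auto)
qed

text \<open>A point that leaves the corner leaves X or Z. The first kind is a priori only L-finite;
  since \<open>L #> a\<close> misses Z, the preceding lemma makes it finite over the intersection of
  L and M. The coset \<open>M #> b\<close> does the same for the second kind.\<close>

lemma bi_almost_invariant_corner:
  assumes L: "subgroup L G" and M: "subgroup M G"
    and X: "bi_almost_invariant H L X" and Z: "bi_almost_invariant H M Z"
    and a: "a \<in> carrier G" "(L #> a) \<inter> Z = {}" and b: "b \<in> carrier G" "(M #> b) \<inter> X = {}"
  shows "bi_almost_invariant H (L \<inter> M) (X \<inter> Z)"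
proof -
  have "coset_finite G (L \<inter> M) {y \<in> X \<inter> Z. y \<otimes> s \<notin> X \<inter> Z}" if s: "s \<in> carrier G" for s
  proof -
    have "coset_finite G (L \<inter> M) ({y \<in> X. y \<otimes> s \<notin> X} \<inter> Z)"
      by (rule coset_finite_Int_almost_invariant[OF L M Z a bi_almost_invariantD(4)[OF X s]])
    moreover have "coset_finite G (M \<inter> L) ({y \<in> Z. y \<otimes> s \<notin> Z} \<inter> X)"
      by (rule coset_finite_Int_almost_invariant[OF M L X b bi_almost_invariantD(4)[OF Z s]])
    ultimately have "coset_finite G (L \<inter> M) ({y \<in> X. y \<otimes> s \<notin> X} \<inter> Z \<union> {y \<in> Z. y \<otimes> s \<notin> Z} \<inter> X)"
      by (intro coset_finite_Un) (simp_all add: Int_commute)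
    then show ?thesis by (rule coset_finite_mono) auto
  qed
  then show ?thesis using X Z unfolding bi_almost_invariant_def by auto
qed

text \<open>Finiteness over M passes up to the conjugate of L and is then translated back by
  \<open>inv x\<close>, so it would contradict properness of A.\<close>

lemma coset_proper_l_coset:
  assumes L: "subgroup L G" and A: "A \<subseteq> carrier G" "coset_proper G L A" and x: "x \<in> carrier G"
    and M: "subgroup M G" "M \<subseteq> conj_by x L"
  shows "coset_proper G M (x <# A)"
proof -
  have *: "coset_finite G L B" if B: "B \<subseteq> carrier G" "coset_finite G M (x <# B)" for B
  proof -
    have "coset_finite G (conj_by x L) (x <# B)"
      using coset_finite_supergroup[OF conj_by_subgroup[OF x L] M B(2)] .
    then have "coset_finite G (conj_by (inv x) (conj_by x L)) (inv x <# (x <# B))"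
      using coset_finite_l_coset conj_by_subgroup x L by simp
    moreover have "conj_by (inv x) (conj_by x L) = L"
    proof -
      have "conj_by x L \<subseteq> carrier G"
        using conj_by_subgroup[OF x L] by (rule subgroup.subset)
      moreover have "inv x \<otimes> (x \<otimes> y \<otimes> inv x) \<otimes> x = y" if "y \<in> carrier G" for y
        using that x by (simp add: m_assoc) (simp add: m_assoc[symmetric])
      ultimately show ?thesis
        using x subgroup.subset[OF L] by (auto simp: mem_conj_by subset_iff)
    qed
    ultimately show ?thesis using x B by (simp add: l_coset_inv_cancel)
  qed
  show ?thesis
    using *[of A] *[of "carrier G - A"] A x unfolding coset_proper_def
    by (auto simp: l_coset_compl)
qed

text \<open>If y is in B and y s is not, then every g with g B = B moves y to a point of B that also
  leaves B under s. The stabilizer thus lies in a right translate of one coboundary.\<close>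

lemma coset_finite_edge_stab:
  assumes L: "subgroup L G" and B: "bi_almost_invariant H L B" "B \<noteq> {}" "B \<noteq> carrier G"
  shows "coset_finite G L {g \<in> carrier G. g <# B = B}"
proof -
  note BD = bi_almost_invariantD[OF B(1)]
  obtain y z where y: "y \<in> B" "y \<in> carrier G" and z: "z \<in> carrier G" "z \<notin> B" using B BD(1) by blast
  define s where "s = inv y \<otimes> z"
  have s: "s \<in> carrier G" "y \<otimes> s = z" using y z by (simp_all add: s_def m_assoc[symmetric])
  have "{g \<in> carrier G. g <# B = B} \<subseteq> {x \<in> B. x \<otimes> s \<notin> B} #> inv y"
  proof
    fix g assume "g \<in> {g \<in> carrier G. g <# B = B}"
    then have g: "g \<in> carrier G" "g <# B = B" by auto
    have "g \<otimes> y \<in> B" "g \<otimes> y \<otimes> s \<notin> B"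
      using g y z s BD(1) mem_l_coset[OF g(1) BD(1), of "g \<otimes> y"] mem_l_coset[OF g(1) BD(1), of "g \<otimes> y \<otimes> s"]
      by (simp_all add: m_assoc[symmetric])
    moreover have "g = (g \<otimes> y) \<otimes> inv y" using g y by (simp add: m_assoc)
    ultimately show "g \<in> {x \<in> B. x \<otimes> s \<notin> B} #> inv y" unfolding r_coset_def by blast
  qed
  moreover have "coset_finite G L ({x \<in> B. x \<otimes> s \<notin> B} #> inv y)"
    using L BD(4)[OF s(1)] y by (intro coset_finite_r_coset) auto
  ultimately show ?thesis by (rule coset_finite_mono[rotated])
qed

lemma commensurable_finite_index:
  assumes L: "subgroup L G" and C: "subgroup C G" "L \<subseteq> C" "coset_finite G L C"
  shows "commensurable G C L"
proof -
  interpret L: subgroup L G by fact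
  interpret C: subgroup C G by fact
  obtain F where F: "finite F" "F \<subseteq> carrier G" "C \<subseteq> (\<Union>f\<in>F. L #> f)"
    using C(3) by (auto simp: coset_finite_iff[OF L])
  have "rcosets\<^bsub>G\<lparr>carrier := K\<rparr>\<^esub> L \<subseteq> (\<lambda>f. L #> f) ` F" if "K \<subseteq> C" for K
  proof
    fix X assume "X \<in> rcosets\<^bsub>G\<lparr>carrier := K\<rparr>\<^esub> L"
    then obtain c where c: "c \<in> K" "X = L #> c" by (auto simp: RCOSETS_def r_coset_def)
    then obtain f where "f \<in> F" "c \<in> L #> f" using F \<open>K \<subseteq> C\<close> by blast
    then show "X \<in> (\<lambda>f. L #> f) ` F"
      using c repr_independence[of c L f] F(2) L by (metis imageI subsetD)
  qed
  then have "finite (rcosets\<^bsub>G\<lparr>carrier := K\<rparr>\<^esub> L)" if "K \<subseteq> C" for K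
    using that F(1) finite_surj[of F] by (meson finite_imageI finite_subset)
  moreover have "C \<inter> L = L" using C(2) by blast
  ultimately show ?thesis unfolding commensurable_def using C(2) by simp
qed

text \<open>B satisfies the assumptions of \<open>nested_half_space\<close>. Its stabilizer contains
  L, which fixes B, and does so with finite index by \<open>coset_finite_edge_stab\<close>.\<close>

lemma nested_almost_invariant_splitting:
  assumes L: "subgroup L G" and B: "bi_almost_invariant H L B" "coset_proper G L B"
    and nested: "\<And>g. g \<in> carrier G \<Longrightarrow>
      B \<subseteq> g <# B \<or> g <# B \<subseteq> B \<or> B \<inter> (g <# B) = {} \<or> B \<union> (g <# B) = carrier G"
  shows "\<exists>C. splits_nontrivially_over G C \<and> commensurable G C L"
proof -
  note BD = bi_almost_invariantD[OF B(1)]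
  interpret L: subgroup L G by fact
  let ?C = "{g \<in> carrier G. g <# B = B}"
  have proper: "B \<noteq> {}" "B \<noteq> carrier G"
    using B(2) unfolding coset_proper_def by auto
  have C_fin: "coset_finite G L ?C"
    by (rule coset_finite_edge_stab[OF L B(1) proper])
  \<comment> \<open>A set inside one right coset of the stabilizer of B is L-finite. If
    \<open>no_disjoint\<close> failed, every translate meeting B would equal B, and B would be such
    a set; if \<open>no_covering\<close> failed, its complement would be.\<close>
  have coset: "coset_finite G L D" if D: "D \<subseteq> carrier G" "a \<in> D" 
    and "\<And>y. y \<in> D \<Longrightarrow> y \<otimes> inv a \<in> ?C" for D a
  proof -
    have "D \<subseteq> ?C #> a"
      using that by (auto simp: mem_r_coset subset_iff)
    then show ?thesis using coset_finite_r_coset[OF L C_fin, of a] D by (blast intro: coset_finite_mono)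
  qed
  have move: "y \<in> (y \<otimes> inv a) <# D" if "a \<in> D" "D \<subseteq> carrier G" "y \<in> carrier G" for a y D
    using that by (auto simp: mem_l_coset inv_mult_group m_assoc subset_iff)
  interpret nested_half_space G B
  proof
    show "finite {Z \<in> (\<lambda>g. g <# B) ` carrier G. x \<in> Z \<and> y \<notin> Z}"
      if x: "x \<in> carrier G" and y: "y \<in> carrier G" for x y
    proof -
      define s where "s = inv x \<otimes> y"
      have s: "s \<in> carrier G" "x \<otimes> s = y" using x y by (simp_all add: s_def m_assoc[symmetric])
      obtain F where F: "finite F" "F \<subseteq> carrier G" "{z \<in> B. z \<otimes> s \<notin> B} \<subseteq> (\<Union>f\<in>F. L #> f)"
        using BD(4)[OF s(1)] by (auto simp: coset_finite_iff[OF L])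
      \<comment> \<open>If g B separates x from x s, then \<open>inv g \<otimes> x\<close> is in the
        coboundary for s and so has the form l f, with l in L and f from a finite set. As l fixes B,
        the translate g B is determined by f.\<close>
      have "{Z \<in> (\<lambda>g. g <# B) ` carrier G. x \<in> Z \<and> y \<notin> Z} \<subseteq> (\<lambda>f. (x \<otimes> inv f) <# B) ` F"
      proof
        fix Z assume "Z \<in> {Z \<in> (\<lambda>g. g <# B) ` carrier G. x \<in> Z \<and> y \<notin> Z}"
        then obtain g where g: "g \<in> carrier G" "Z = g <# B" "x \<in> g <# B" "y \<notin> g <# B" by blast
        have "inv g \<otimes> x \<in> B" using g BD(1) by (simp add: mem_l_coset)
        moreover have "inv g \<otimes> x \<otimes> s = inv g \<otimes> y"
          using g(1) x s by (simp add: m_assoc)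
        then have "inv g \<otimes> x \<otimes> s \<notin> B" using g y BD(1) by (simp add: mem_l_coset)
        ultimately obtain f l where f: "f \<in> F" "l \<in> L" "inv g \<otimes> x = l \<otimes> f"
          using F(3) by (force simp: r_coset_def)
        then have fG: "f \<in> carrier G" "l \<in> carrier G" using F by auto
        have "l <# B \<subseteq> B" "inv l <# B \<subseteq> B"
          using f(2) BD(2) by (auto simp: l_coset_def)
        then have "l <# B = B"
          using l_coset_mono[of "inv l <# B" B l] fG BD(1) by (simp add: l_coset_inv_cancel)
        moreover have "x \<otimes> inv f = g \<otimes> l"
        proof -
          have "x = g \<otimes> (inv g \<otimes> x)" using g(1) x by (simp add: m_assoc[symmetric])
          also have "\<dots> = g \<otimes> l \<otimes> f" using f(3) g(1) fG by (simp add: m_assoc)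
          finally show ?thesis using g(1) fG by (simp add: m_assoc)
        qed
        ultimately have "Z = (x \<otimes> inv f) <# B"
          using g fG BD(1) by (simp add: lcos_m_assoc[symmetric])
        then show "Z \<in> (\<lambda>f. (x \<otimes> inv f) <# B) ` F" using f(1) by blast
      qed
      then show ?thesis using F(1) by (meson finite_imageI finite_subset)
    qed
    show "\<exists>g\<in>carrier G. g <# B \<noteq> B \<and> (g <# B) \<inter> B \<noteq> {}"
    proof (rule ccontr)
      assume *: "\<not> ?thesis"
      obtain a where a: "a \<in> B" using proper by blast
      have "coset_finite G L B"
      proof (rule coset[OF BD(1) a])
        fix y assume y: "y \<in> B"
        then have "y \<otimes> inv a \<in> carrier G" "y \<in> (y \<otimes> inv a) <# B"
          using a BD(1) move[OF a BD(1)] by auto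
        then show "y \<otimes> inv a \<in> ?C" using * y by blast
      qed
      then show False using B(2) by (simp add: coset_proper_def)
    qed
    show "\<exists>g\<in>carrier G. g <# B \<noteq> B \<and> (g <# B) \<union> B \<noteq> carrier G"
    proof (rule ccontr)
      assume *: "\<not> ?thesis"
      obtain a where a: "a \<in> carrier G - B" using proper BD(1) by blast
      have "coset_finite G L (carrier G - B)"
      proof (rule coset[OF _ a])
        fix y assume y: "y \<in> carrier G - B"
        then have g: "y \<otimes> inv a \<in> carrier G" using a by auto
        moreover have "y \<in> (y \<otimes> inv a) <# (carrier G - B)"
          using y move[OF a] by auto
        then have "y \<notin> (y \<otimes> inv a) <# B" using g BD(1) by (simp add: l_coset_compl)
        ultimately show "y \<otimes> inv a \<in> ?C" using * y by blast
      qed auto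
      then show False using B(2) by (simp add: coset_proper_def)
    qed
  qed (use BD(1) proper nested in auto)
  have "L \<subseteq> edge_stab"
  proof
    fix l assume l: "l \<in> L"
    have "l <# B \<subseteq> B" "inv l <# B \<subseteq> B"
      using l BD(2) by (auto simp: l_coset_def)
    then have "l <# B = B"
      using l_coset_mono[of "inv l <# B" B l] l BD(1) by (simp add: l_coset_inv_cancel)
    then show "l \<in> edge_stab" using l by (simp add: edge_stab_def)
  qed
  moreover have "coset_finite G L edge_stab" using C_fin by (simp add: edge_stab_def)
  ultimately have "commensurable G edge_stab L"
    by (intro commensurable_finite_index L edge_stab_subgroup)
  then show ?thesis using splits_over_edge_stab by blast
qed

section \<open>Stabilizers of finite sets of cosets\<close>

text \<open>The stabilizer of a coset y H is the conjugate of H by y. With sets of cosets as index,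
  intersecting such subgroups becomes a union and conjugating them a translation, so shrinking L
  means enlarging S.\<close>

definition coset_stab where "coset_stab S = {y \<in> carrier G. \<forall>c\<in>S. y <# c = c}"

lemma coset_stab_subgroup:
  assumes "S \<subseteq> Pow (carrier G)"
  shows "subgroup (coset_stab S) G"
proof (rule subgroupI)
  have sub: "c \<subseteq> carrier G" if "c \<in> S" for c using assms that by blast
  show "coset_stab S \<noteq> {}"
    using sub by (auto simp: coset_stab_def lcos_mult_one intro!: exI[of _ \<one>])
  show "inv y \<in> coset_stab S" if "y \<in> coset_stab S" for y
  proof -
    have y: "y \<in> carrier G" "\<And>c. c \<in> S \<Longrightarrow> y <# c = c" using that by (auto simp: coset_stab_def)
    have "inv y <# c = c" if "c \<in> S" for c
      using l_coset_inv_cancel(1)[OF y(1) sub[OF that]] y(2)[OF that] by simp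
    then show ?thesis using y(1) by (simp add: coset_stab_def)
  qed
  show "y \<otimes> z \<in> coset_stab S" if "y \<in> coset_stab S" "z \<in> coset_stab S" for y z
    using that sub by (auto simp: coset_stab_def lcos_m_assoc[symmetric])
qed (auto simp: coset_stab_def)

lemma coset_stab_Un: "coset_stab (S \<union> T) = coset_stab S \<inter> coset_stab T"
  by (auto simp: coset_stab_def)

lemma coset_stab_l_coset:
  assumes S: "S \<subseteq> Pow (carrier G)" and g: "g \<in> carrier G"
  shows "coset_stab ((\<lambda>c. g <# c) ` S) = conj_by g (coset_stab S)"
proof -
  have "y <# (g <# c) = g <# c \<longleftrightarrow> (inv g \<otimes> y \<otimes> g) <# c = c" if "y \<in> carrier G" "c \<in> S" for y c
  proof -
    have c: "c \<subseteq> carrier G" using S that by blast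
    have "(inv g \<otimes> y \<otimes> g) <# c = inv g <# (y <# (g <# c))"
      using c that g l_coset_subset_G by (simp add: lcos_m_assoc m_assoc)
    then have "(inv g \<otimes> y \<otimes> g) <# c = c \<longleftrightarrow> inv g <# (y <# (g <# c)) = inv g <# (g <# c)"
      using c g by (simp add: l_coset_inv_cancel)
    also have "\<dots> \<longleftrightarrow> y <# (g <# c) = g <# c"
      using c g that l_coset_subset_G by (intro l_coset_eq_iff) auto
    finally show ?thesis ..
  qed
  moreover have "coset_stab S \<subseteq> carrier G" by (auto simp: coset_stab_def)
  ultimately show ?thesis
    using g by (auto simp: mem_conj_by) (auto simp: coset_stab_def)
qed

lemma coset_stab_singleton:
  assumes "subgroup H G"
  shows "coset_stab {H} = H"
proof -
  interpret H: subgroup H G by fact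
  have "y \<in> H" if "y \<in> carrier G" "y <# H = H" for y
    using that H.one_closed by (force simp: l_coset_def)
  moreover have "h <# H = H" if "h \<in> H" for h
    using that coset_join3[of h H] assms by simp
  ultimately show ?thesis by (auto simp: coset_stab_def)
qed

definition has_proper_almost_invariant where
  "has_proper_almost_invariant H L \<longleftrightarrow>
    (\<exists>A. bi_almost_invariant H L A \<and> coset_proper G L A)"

lemma set_mult_sandwich_eq_iff:
  assumes L: "subgroup L G" and A: "A \<subseteq> carrier G"
  shows "L <#> A <#> L = A \<longleftrightarrow> (\<forall>l\<in>L. \<forall>a\<in>A. l \<otimes> a \<in> A \<and> a \<otimes> l \<in> A)"
proof
  assume *: "L <#> A <#> L = A"
  interpret L: subgroup L G by fact
  show "\<forall>l\<in>L. \<forall>a\<in>A. l \<otimes> a \<in> A \<and> a \<otimes> l \<in> A"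
  proof (intro ballI)
    fix l a assume la: "l \<in> L" "a \<in> A"
    then have "l \<otimes> a \<otimes> \<one> \<in> L <#> A <#> L" "\<one> \<otimes> a \<otimes> l \<in> L <#> A <#> L"
      using L.one_closed unfolding set_mult_def by blast+
    then show "l \<otimes> a \<in> A \<and> a \<otimes> l \<in> A" using * la A by (auto simp: subset_iff)
  qed
next
  assume *: "\<forall>l\<in>L. \<forall>a\<in>A. l \<otimes> a \<in> A \<and> a \<otimes> l \<in> A"
  interpret L: subgroup L G by fact
  have "a \<in> L <#> A <#> L" if "a \<in> A" for a
  proof -
    have "\<one> \<otimes> a \<otimes> \<one> \<in> L <#> A <#> L"
      using that L.one_closed unfolding set_mult_def by blast
    then show ?thesis using that A by (auto simp: subset_iff)
  qed
  moreover have "L <#> A <#> L \<subseteq> A" using * unfolding set_mult_def by blast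
  ultimately show "L <#> A <#> L = A" by blast
qed

text \<open>Maximality among the supersets of S suffices: every competitor below is a union of S
  with translates of S.\<close>

context
  fixes H S
  assumes H: "subgroup H G"
    and S: "finite S" "S \<subseteq> (\<lambda>y. y <# H) ` carrier G" "H \<in> S"
    and max: "\<And>T. finite T \<Longrightarrow> T \<subseteq> (\<lambda>y. y <# H) ` carrier G \<Longrightarrow> S \<subseteq> T \<Longrightarrow>
      has_proper_almost_invariant H (coset_stab T) \<Longrightarrow> T = S"
begin

private lemma cosets_subset: "T \<subseteq> (\<lambda>y. y <# H) ` carrier G \<Longrightarrow> T \<subseteq> Pow (carrier G)"
  using l_coset_subset_G[OF subgroup.subset[OF H]] by auto

private lemma l_coset_cosets:
  "T \<subseteq> (\<lambda>y. y <# H) ` carrier G \<Longrightarrow> g \<in> carrier G \<Longrightarrow>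
    (\<lambda>c. g <# c) ` T \<subseteq> (\<lambda>y. y <# H) ` carrier G"
  using subgroup.subset[OF H] by (auto simp: lcos_m_assoc)

private lemma stab_subgroup: "subgroup (coset_stab S) G"
  using coset_stab_subgroup cosets_subset S(2) by blast

private lemma stab_le: "coset_stab S \<subseteq> H"
  using coset_stab_singleton[OF H] S(3) by (auto simp: coset_stab_def)

text \<open>The conditions on g and \<open>inv g\<close> select the corner. X and g Y are right
  invariant under H, which contains L, so g L misses X and L misses g Y. These are the two cosets
  that \<open>bi_almost_invariant_corner\<close> asks for.\<close>

lemma corner_empty:
  assumes X: "bi_almost_invariant H (coset_stab S) X" "coset_proper G (coset_stab S) X"
    and Y: "bi_almost_invariant H (coset_stab S) Y"
    and g: "g \<in> carrier G" "(\<lambda>c. g <# c) ` S \<noteq> S" "g \<notin> X" "inv g \<notin> Y"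
  shows "X \<inter> (g <# Y) = {}"
proof (rule ccontr)
  let ?L = "coset_stab S" and ?Z = "g <# Y"
  let ?M = "conj_by g ?L" and ?T = "S \<union> (\<lambda>c. g <# c) ` S"
  assume nonempty: "X \<inter> ?Z \<noteq> {}"
  note XD = bi_almost_invariantD[OF X(1)] and YD = bi_almost_invariantD[OF Y]
  have L: "subgroup ?L G" by (rule stab_subgroup)
  interpret L: subgroup ?L G by fact
  have M: "subgroup ?M G" by (rule conj_by_subgroup[OF g(1) L])
  have LM: "subgroup (?L \<inter> ?M) G" by (rule subgroups_Inter_pair[OF L M])
  have Z: "bi_almost_invariant H ?M ?Z"
    by (rule bi_almost_invariant_l_coset[OF L H g(1) Y])
  note ZD = bi_almost_invariantD[OF Z]
  have T: "finite ?T" "?T \<subseteq> (\<lambda>y. y <# H) ` carrier G" "S \<subseteq> ?T"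
    using S l_coset_cosets g(1) by auto
  have stab_T: "coset_stab ?T = ?L \<inter> ?M"
    using coset_stab_Un coset_stab_l_coset[OF cosets_subset[OF S(2)] g(1)] by simp
  have "?T \<noteq> S"
  proof
    assume "?T = S"
    then have "(\<lambda>c. g <# c) ` S \<subseteq> S" by blast
    moreover have "inj_on (\<lambda>c. g <# c) S"
    proof (rule inj_onI)
      fix c d assume "c \<in> S" "d \<in> S" "g <# c = g <# d"
      moreover from this have "c \<subseteq> carrier G" "d \<subseteq> carrier G"
        using cosets_subset[OF S(2)] by blast+
      ultimately show "c = d" using l_coset_eq_iff[OF g(1)] by blast
    qed
    then have "card ((\<lambda>c. g <# c) ` S) = card S" by (rule card_image)
    ultimately show False using card_subset_eq[OF S(1)] g(2) by blast
  qed
  have "(?L #> \<one>) \<inter> ?Z = {}"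
  proof (rule ccontr)
    assume "(?L #> \<one>) \<inter> ?Z \<noteq> {}"
    then obtain l where l: "l \<in> ?L" "l \<in> ?Z" using L.subset by (auto simp: coset_mult_one)
    then have "l \<otimes> inv l \<in> ?Z" using stab_le ZD(3)[of "inv l" l] by blast
    then show False using l g YD(1) by (simp add: mem_l_coset)
  qed
  moreover have "(?M #> g) \<inter> X = {}"
  proof (rule ccontr)
    assume "(?M #> g) \<inter> X \<noteq> {}"
    moreover have "?M #> g = g <# ?L"
      using l_coset_r_coset_conj_by[of g \<one> ?L] g L.subset by (simp add: coset_mult_one)
    ultimately obtain l where l: "l \<in> ?L" "g \<otimes> l \<in> X" by (auto simp: l_coset_def)
    then have "g \<otimes> l \<otimes> inv l \<in> X" using stab_le XD(3)[of "inv l" "g \<otimes> l"] by blast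
    then show False using l g by (simp add: m_assoc)
  qed
  ultimately have corner: "bi_almost_invariant H (?L \<inter> ?M) (X \<inter> ?Z)"
    using bi_almost_invariant_corner[OF L M X(1) Z, of \<one> g] g(1) by simp
  \<comment> \<open>The complement of the corner contains that of X, so the corner can fail to be
    proper only by being finite.\<close>
  have "\<not> coset_finite G (?L \<inter> ?M) (carrier G - (X \<inter> ?Z))"
  proof
    assume "coset_finite G (?L \<inter> ?M) (carrier G - (X \<inter> ?Z))"
    then have "coset_finite G ?L (carrier G - (X \<inter> ?Z))"
      by (rule coset_finite_supergroup[OF L LM Int_lower1])
    then have "coset_finite G ?L (carrier G - X)" by (rule coset_finite_mono) auto
    then show False using X(2) by (simp add: coset_proper_def)
  qed
  moreover have "\<not> coset_proper G (?L \<inter> ?M) (X \<inter> ?Z)"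
    using corner max[OF T] \<open>?T \<noteq> S\<close> by (auto simp: stab_T has_proper_almost_invariant_def)
  ultimately have finite: "coset_finite G (?L \<inter> ?M) (X \<inter> ?Z)"
    by (simp add: coset_proper_def)
  obtain x where x: "x \<in> X" "x \<in> ?Z" using nonempty by blast
  then have xG: "x \<in> carrier G" using XD(1) by blast
  let ?K = "conj_by x ?L" and ?R = "?T \<union> (\<lambda>c. x <# c) ` S"
  let ?M1 = "(?L \<inter> ?M) \<inter> ?K"
  have K: "subgroup ?K G" by (rule conj_by_subgroup[OF xG L])
  have M1: "subgroup ?M1 G" by (rule subgroups_Inter_pair[OF LM K])
  have R: "finite ?R" "?R \<subseteq> (\<lambda>y. y <# H) ` carrier G" "S \<subseteq> ?R" "?R \<noteq> S"
    using S T l_coset_cosets[OF S(2) xG] \<open>?T \<noteq> S\<close> by auto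
  have stab_R: "coset_stab ?R = ?M1"
    using coset_stab_Un[of ?T] stab_T coset_stab_l_coset[OF cosets_subset[OF S(2)] xG] by simp
  have "x \<otimes> l \<in> X \<inter> ?Z" if "l \<in> ?L" for l
    using x XD(3) ZD(3) stab_le that by blast
  then have "x <# ?L \<subseteq> X \<inter> ?Z" unfolding l_coset_def[of _ x] by blast
  \<comment> \<open>Right translation turns x L into the conjugate \<open>?K\<close>, which is thus
    finite over \<open>?L \<inter> ?M\<close>. So \<open>?M1\<close> has finite index in
    \<open>?K\<close>, and almost invariance of x X over \<open>?K\<close> descends to
    \<open>?M1\<close>.\<close>
  then have "coset_finite G (?L \<inter> ?M) (x <# ?L #> inv x)"
    using finite xG by (intro coset_finite_r_coset LM) (auto intro: coset_finite_mono)
  then have "coset_finite G (?L \<inter> ?M) ?K" by (simp add: conj_by_def)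
  then have index: "coset_finite G ?M1 ?K"
    using coset_finite_Int[OF LM K _ coset_finite_self[OF K]] by fastforce
  have "bi_almost_invariant H ?M1 (x <# X)"
    using bi_almost_invariant_finite_index[OF K M1 Int_lower2 index]
      bi_almost_invariant_l_coset[OF L H xG X(1)] by blast
  moreover have "coset_proper G ?M1 (x <# X)"
    by (rule coset_proper_l_coset[OF L XD(1) X(2) xG M1 Int_lower2])
  ultimately have "has_proper_almost_invariant H (coset_stab ?R)"
    unfolding has_proper_almost_invariant_def stab_R by blast
  then show False using max[OF R(1-3)] R(4) by blast
qed

text \<open>X and Y are taken from B and its complement so that g is not in X and
  \<open>inv g\<close> is not in Y. The four possible empty corners are the four ways of being
  nested.\<close>

lemma nested_outside_setwise_stabilizer:
  assumes B: "bi_almost_invariant H (coset_stab S) B" "coset_proper G (coset_stab S) B"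
    and g: "g \<in> carrier G" "(\<lambda>c. g <# c) ` S \<noteq> S"
  shows "B \<subseteq> g <# B \<or> g <# B \<subseteq> B \<or> B \<inter> (g <# B) = {} \<or> B \<union> (g <# B) = carrier G"
proof -
  let ?B = "carrier G - B"
  have BG: "B \<subseteq> carrier G" by (rule bi_almost_invariantD[OF B(1)])
  have B': "bi_almost_invariant H (coset_stab S) ?B"
    by (rule bi_almost_invariant_compl[OF stab_subgroup H B(1)])
  have "coset_proper G (coset_stab S) ?B"
    using B(2) BG by (simp add: coset_proper_def double_diff)
  note corner = corner_empty[OF B _ g] corner_empty[OF B' this _ g]
  have c: "g <# ?B = carrier G - (g <# B)" using g BG by (simp add: l_coset_compl)
  have gB: "g <# B \<subseteq> carrier G" using g BG by (simp add: l_coset_subset_G)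
  show ?thesis
  proof (cases "g \<in> B"; cases "inv g \<in> B")
    assume "g \<in> B" "inv g \<in> B"
    then have "?B \<inter> (g <# ?B) = {}" using corner(2)[OF B'] by blast
    then show ?thesis using BG gB unfolding c by blast
  next
    assume "g \<in> B" "inv g \<notin> B"
    then have "?B \<inter> (g <# B) = {}" using corner(2)[OF B(1)] by blast
    then show ?thesis using BG gB by blast
  next
    assume "g \<notin> B" "inv g \<in> B"
    then have "B \<inter> (g <# ?B) = {}" using corner(1)[OF B'] by blast
    then show ?thesis using BG gB unfolding c by blast
  next
    assume "g \<notin> B" "inv g \<notin> B"
    then show ?thesis using corner(1)[OF B(1)] by blast
  qed
qed

text \<open>The setwise stabilizer of \<open>S\<close> contains the pointwise one with finite index, so only finitely
  many translates of \<open>A\<close> arise from it. An infinite atom of the Boolean algebra that they generate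
  is equal to or disjoint from each of its translates by this stabilizer.\<close>

lemma ex_nested:
  assumes A: "bi_almost_invariant H (coset_stab S) A" "coset_proper G (coset_stab S) A"
  shows "\<exists>B. bi_almost_invariant H (coset_stab S) B \<and> coset_proper G (coset_stab S) B \<and>
    (\<forall>g\<in>carrier G.
      B \<subseteq> g <# B \<or> g <# B \<subseteq> B \<or> B \<inter> (g <# B) = {} \<or> B \<union> (g <# B) = carrier G)"
proof -
  let ?L = "coset_stab S"
  note AD = bi_almost_invariantD[OF A(1)]
  have L: "subgroup ?L G" by (rule stab_subgroup)
  interpret L: subgroup ?L G by fact
  have SG: "c \<subseteq> carrier G" if "c \<in> S" for c using cosets_subset[OF S(2)] that by blast
  define N where "N = {g \<in> carrier G. (\<lambda>c. g <# c) ` S = S}"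
  have NG: "N \<subseteq> carrier G" by (auto simp: N_def)
  have N_mult: "g \<otimes> h \<in> N" if "g \<in> N" "h \<in> N" for g h
  proof -
    have gh: "g \<in> carrier G" "h \<in> carrier G" using that by (auto simp: N_def)
    then have "(\<lambda>c. (g \<otimes> h) <# c) ` S = (\<lambda>c. g <# (h <# c)) ` S"
      using SG by (intro image_cong) (auto simp: lcos_m_assoc)
    also have "\<dots> = (\<lambda>c. g <# c) ` ((\<lambda>c. h <# c) ` S)" by (simp add: image_image)
    also have "\<dots> = S" using that by (simp add: N_def)
    finally show ?thesis using gh by (simp add: N_def)
  qed
  have N_inv: "inv g \<in> N" if "g \<in> N" for g
  proof -
    have g: "g \<in> carrier G" "(\<lambda>c. g <# c) ` S = S" using that by (auto simp: N_def)
    have "(\<lambda>c. inv g <# c) ` S = (\<lambda>c. inv g <# c) ` ((\<lambda>c. g <# c) ` S)" using g(2) by simp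
    also have "\<dots> = (\<lambda>c. c) ` S"
      unfolding image_image using g(1) SG by (intro image_cong) (auto simp: l_coset_inv_cancel)
    finally show ?thesis using g(1) by (simp add: N_def)
  qed
  define F where "F = (\<lambda>g. g <# A) ` N"
  \<comment> \<open>Elements that permute S in the same way differ by an element of L, which fixes
    A. Hence there are at most as many translates as permutations of S.\<close>
  have same: "g <# A = h <# A"
    if g: "g \<in> N" "h \<in> N" "restrict (\<lambda>c. g <# c) S = restrict (\<lambda>c. h <# c) S" for g h
  proof -
    have gh: "g \<in> carrier G" "h \<in> carrier G" using g NG by auto
    have eq: "g <# c = h <# c" if "c \<in> S" for c
      using fun_cong[OF g(3), of c] that by simp
    define l where "l = inv g \<otimes> h"
    have "l <# c = c" if "c \<in> S" for c
    proof -
      have "l <# c = inv g <# (h <# c)" using gh SG[OF that] by (simp add: l_def lcos_m_assoc)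
      also have "\<dots> = inv g <# (g <# c)" by (simp only: eq[OF that])
      also have "\<dots> = c" by (rule l_coset_inv_cancel(1)[OF gh(1) SG[OF that]])
      finally show ?thesis .
    qed
    moreover have "l \<in> carrier G" using gh by (simp add: l_def)
    ultimately have l: "l \<in> ?L" unfolding coset_stab_def by blast
    then have "l <# A \<subseteq> A" "inv l <# A \<subseteq> A"
      using AD(2) by (auto simp: l_coset_def)
    then have "l <# A = A"
      using l_coset_mono[of "inv l <# A" A l] l AD(1) by (simp add: l_coset_inv_cancel)
    moreover have "h = g \<otimes> l" using gh by (simp add: l_def m_assoc[symmetric])
    ultimately show ?thesis using gh l AD(1) by (simp add: lcos_m_assoc[symmetric])
  qed
  have "finite F"
  proof -
    let ?r = "\<lambda>g. restrict (\<lambda>c. g <# c) S"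
    have "?r ` N \<subseteq> S \<rightarrow>\<^sub>E S" by (auto simp: N_def)
    then have fin: "finite (?r ` N)" using S(1) by (meson finite_PiE finite_subset)
    have "F \<subseteq> (\<lambda>f. (SOME g. g \<in> N \<and> ?r g = f) <# A) ` ?r ` N"
    proof
      fix Z assume "Z \<in> F"
      then obtain g where g: "g \<in> N" "Z = g <# A" by (auto simp: F_def)
      define h where "h = (SOME h. h \<in> N \<and> ?r h = ?r g)"
      have h: "h \<in> N \<and> ?r h = ?r g"
        unfolding h_def by (rule someI[of _ g]) (simp add: g)
      have "Z = h <# A" unfolding g(2) using h by (intro same g(1)) simp_all
      then show "Z \<in> (\<lambda>f. (SOME g. g \<in> N \<and> ?r g = f) <# A) ` ?r ` N" using g(1) unfolding h_def by blast
    qed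
    then show ?thesis using fin by (meson finite_imageI finite_subset)
  qed
  \<comment> \<open>As g S = S, conjugation by g preserves L, so the translate is almost invariant
    over the same group.\<close>
  have F_inv: "bi_almost_invariant H ?L Z" if "Z \<in> F" for Z
  proof -
    obtain g where g: "g \<in> carrier G" "(\<lambda>c. g <# c) ` S = S" "Z = g <# A"
      using \<open>Z \<in> F\<close> by (auto simp: F_def N_def)
    then have "conj_by g ?L = ?L"
      using coset_stab_l_coset[OF cosets_subset[OF S(2)] g(1)] by simp
    then show ?thesis using bi_almost_invariant_l_coset[OF L H g(1) A(1)] g(3) by simp
  qed
  define atom where "atom = (\<lambda>x. {y \<in> carrier G. \<forall>Z\<in>F. y \<in> Z \<longleftrightarrow> x \<in> Z})"
  have atom_inv: "bi_almost_invariant H ?L (atom x)" for x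
  proof -
    have "bi_almost_invariant H ?L {y \<in> carrier G. \<forall>Z\<in>F'. y \<in> Z \<longleftrightarrow> x \<in> Z}"
      if "finite F'" "F' \<subseteq> F" for F'
      using that
    proof (induction F' rule: finite_induct)
      case empty
      then show ?case using bi_almost_invariant_carrier[OF L H] by simp
    next
      case (insert Z F')
      let ?Z = "if x \<in> Z then Z else carrier G - Z"
      have "bi_almost_invariant H ?L ?Z"
        using F_inv[of Z] insert.prems bi_almost_invariant_compl[OF L H] by auto
      moreover have "bi_almost_invariant H ?L {y \<in> carrier G. \<forall>Z\<in>F'. y \<in> Z \<longleftrightarrow> x \<in> Z}"
        using insert by simp
      moreover have "{y \<in> carrier G. \<forall>Z\<in>insert Z F'. y \<in> Z \<longleftrightarrow> x \<in> Z} =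
          {y \<in> carrier G. \<forall>Z\<in>F'. y \<in> Z \<longleftrightarrow> x \<in> Z} \<inter> ?Z"
        by auto
      ultimately show ?case using bi_almost_invariant_Int by (simp only:)
    qed
    then show ?thesis using \<open>finite F\<close> by (simp add: atom_def)
  qed
  have "A \<in> F"
  proof -
    have "(\<lambda>c. \<one> <# c) ` S = (\<lambda>c. c) ` S" using SG by (intro image_cong) (auto simp: lcos_mult_one)
    then have "\<one> \<in> N" by (simp add: N_def)
    then show ?thesis using AD(1) lcos_mult_one[of A] unfolding F_def by (metis image_eqI)
  qed
  have "\<exists>x\<in>A. \<not> coset_finite G ?L (atom x)"
  proof (rule ccontr)
    assume *: "\<not> ?thesis"
    \<comment> \<open>An atom is determined by the translates that contain it, so there are finitely
      many. If all atoms of points of A were L-finite, A would be L-finite too.\<close>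
    have "atom ` A \<subseteq> (\<lambda>V. {y \<in> carrier G. \<forall>Z\<in>F. y \<in> Z \<longleftrightarrow> Z \<in> V}) ` Pow F"
    proof
      fix B assume "B \<in> atom ` A"
      then obtain x where "B = atom x" by blast
      then have "B = {y \<in> carrier G. \<forall>Z\<in>F. y \<in> Z \<longleftrightarrow> Z \<in> {Z \<in> F. x \<in> Z}}"
        by (auto simp: atom_def)
      then show "B \<in> (\<lambda>V. {y \<in> carrier G. \<forall>Z\<in>F. y \<in> Z \<longleftrightarrow> Z \<in> V}) ` Pow F"
        by (rule image_eqI) auto
    qed
    then have "finite (atom ` A)" using \<open>finite F\<close> by (meson finite_Pow_iff finite_surj)
    then have "coset_finite G ?L (\<Union>B\<in>atom ` A. B)"
      using * by (intro coset_finite_UN) auto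
    then have "coset_finite G ?L A"
      by (rule coset_finite_mono) (use AD(1) in \<open>auto simp: atom_def\<close>)
    then show False using A(2) by (simp add: coset_proper_def)
  qed
  then obtain x where x: "x \<in> A" "\<not> coset_finite G ?L (atom x)" by blast
  have "atom x \<subseteq> A" using x(1) \<open>A \<in> F\<close> by (auto simp: atom_def)
  then have "\<not> coset_finite G ?L (carrier G - atom x)"
    using A(2) coset_finite_mono[of ?L "carrier G - atom x" "carrier G - A"]
    unfolding coset_proper_def by blast
  then have proper: "coset_proper G ?L (atom x)" using x(2) by (simp add: coset_proper_def)
  \<comment> \<open>N permutes the translates in \<open>F\<close>, hence also the atoms.\<close>
  have atom_translate: "g <# atom x = atom (g \<otimes> x)" if g: "g \<in> N" for g
  proof -
    have gG: "g \<in> carrier G" and xG: "x \<in> carrier G" using g NG x(1) AD(1) by auto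
    have FG: "Z \<subseteq> carrier G" if "Z \<in> F" for Z
      using bi_almost_invariantD(1)[OF F_inv[OF that]] .
    have mem: "h \<otimes> y \<in> h <# Z \<longleftrightarrow> y \<in> Z" if "Z \<in> F" "y \<in> carrier G" "h \<in> carrier G" for Z y h
      using that FG[OF that(1)] by (simp add: mem_l_coset m_assoc[symmetric])
    have F_closed: "h <# Z \<in> F" if "h \<in> N" "Z \<in> F" for h Z
    proof -
      obtain k where k: "k \<in> N" "Z = k <# A" using \<open>Z \<in> F\<close> by (auto simp: F_def)
      then have "h <# Z = (h \<otimes> k) <# A" using that NG AD(1) by (auto simp: lcos_m_assoc subset_iff)
      then show ?thesis using N_mult[OF that(1) k(1)] by (auto simp: F_def)
    qed
    have le: "h \<otimes> y \<in> atom (h \<otimes> z)"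
      if h: "h \<in> N" and y: "y \<in> atom z" and z: "z \<in> carrier G" for h y z
    proof -
      have hG: "h \<in> carrier G" and yG: "y \<in> carrier G" using h y NG by (auto simp: atom_def)
      have "h \<otimes> y \<in> Z \<longleftrightarrow> h \<otimes> z \<in> Z" if Z: "Z \<in> F" for Z
      proof -
        have Z': "inv h <# Z \<in> F" using F_closed N_inv h Z by blast
        then have "y \<in> inv h <# Z \<longleftrightarrow> z \<in> inv h <# Z" using y by (simp add: atom_def)
        then show ?thesis
          using mem[OF Z' yG hG] mem[OF Z' z hG] hG FG[OF Z] by (simp add: l_coset_inv_cancel)
      qed
      then show ?thesis using hG yG by (simp add: atom_def)
    qed
    show ?thesis
    proof
      show "g <# atom x \<subseteq> atom (g \<otimes> x)" using le[OF g _ xG] by (auto simp: l_coset_def)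
      show "atom (g \<otimes> x) \<subseteq> g <# atom x"
      proof
        fix y assume y: "y \<in> atom (g \<otimes> x)"
        then have yG: "y \<in> carrier G" by (simp add: atom_def)
        have "inv g \<otimes> y \<in> atom (inv g \<otimes> (g \<otimes> x))"
          using le[OF N_inv[OF g] y] gG xG by simp
        then have "inv g \<otimes> y \<in> atom x" using gG xG by (simp add: m_assoc[symmetric])
        moreover have "atom x \<subseteq> carrier G" by (auto simp: atom_def)
        ultimately show "y \<in> g <# atom x" using gG yG by (simp add: mem_l_coset)
      qed
    qed
  qed
  have "atom x \<subseteq> g <# atom x \<or> g <# atom x \<subseteq> atom x \<or> atom x \<inter> (g <# atom x) = {} \<or>
      atom x \<union> (g <# atom x) = carrier G" if g: "g \<in> carrier G" for g
  proof (cases "g \<in> N")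
    case True
    have "atom x = atom (g \<otimes> x) \<or> atom x \<inter> atom (g \<otimes> x) = {}"
      by (auto simp: atom_def)
    then show ?thesis using atom_translate[OF True] by auto
  next
    case False
    then show ?thesis
      using nested_outside_setwise_stabilizer[OF atom_inv proper g] g by (simp add: N_def)
  qed
  then show ?thesis using atom_inv proper by blast
qed

lemma splitting_of_maximal:
  assumes "has_proper_almost_invariant H (coset_stab S)"
  shows "\<exists>C K. splits_nontrivially_over G C \<and> subgroup K G \<and> K \<subseteq> H \<and> commensurable G C K"
proof -
  obtain A where "bi_almost_invariant H (coset_stab S) A" "coset_proper G (coset_stab S) A"
    using assms unfolding has_proper_almost_invariant_def by blast
  then obtain B where "bi_almost_invariant H (coset_stab S) B" "coset_proper G (coset_stab S) B"
    "\<And>g. g \<in> carrier G \<Longrightarrow>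
      B \<subseteq> g <# B \<or> g <# B \<subseteq> B \<or> B \<inter> (g <# B) = {} \<or> B \<union> (g <# B) = carrier G"
    using ex_nested by blast
  then show ?thesis
    using nested_almost_invariant_splitting[OF stab_subgroup] stab_subgroup stab_le by blast
qed

end

text \<open>Bridges indexed families of representatives and sets of cosets: enumerate S and choose a
  representative of each coset.\<close>

lemma splitting_compatible_coset_stab:
  assumes H: "subgroup H G" and S: "finite S" "S \<subseteq> (\<lambda>y. y <# H) ` carrier G" "H \<in> S"
    and compat: "\<And>g. g ` {1..card S} \<subseteq> carrier G \<Longrightarrow> inj_on (\<lambda>i. g i <# H) {1..card S} \<Longrightarrow>
      splitting_compatible G (\<Inter>i\<in>{1..card S}. g i <# H #> inv (g i))"
  shows "splitting_compatible G (coset_stab S)"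
proof -
  obtain c where c: "bij_betw c {1..card S} S" using ex_bij_betw_nat_finite_1[OF S(1)] by blast
  define g where "g i = (SOME y. y \<in> carrier G \<and> c i = y <# H)" for i
  have g: "g i \<in> carrier G \<and> c i = g i <# H" if "i \<in> {1..card S}" for i
  proof -
    have "c i \<in> (\<lambda>y. y <# H) ` carrier G" using bij_betwE[OF c] that S(2) by blast
    then have "\<exists>y. y \<in> carrier G \<and> c i = y <# H" by blast
    then show ?thesis unfolding g_def by (rule someI_ex)
  qed
  have "inj_on (\<lambda>i. g i <# H) {1..card S}"
    using bij_betw_imp_inj_on[OF c] g by (metis (no_types, lifting) inj_on_cong)
  moreover have "g ` {1..card S} \<subseteq> carrier G" using g by auto
  ultimately have "splitting_compatible G (\<Inter>i\<in>{1..card S}. g i <# H #> inv (g i))"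
    using compat by blast
  moreover have "(\<Inter>i\<in>{1..card S}. g i <# H #> inv (g i)) = coset_stab S"
  proof -
    have conj: "g i <# H #> inv (g i) = coset_stab {c i}" if "i \<in> {1..card S}" for i
      using coset_stab_l_coset[of "{H}" "g i"] g[OF that] subgroup.subset[OF H] 
        coset_stab_singleton[OF H]
      by (simp add: conj_by_def)
    \<comment> \<open>For an empty index set the intersection would be \<open>UNIV\<close> instead
      of the carrier.\<close>
    have "{1..card S} \<noteq> {}" using S by (auto simp: Suc_le_eq card_gt_0_iff)
    then have "(\<Inter>i\<in>{1..card S}. coset_stab {c i}) = coset_stab (c ` {1..card S})"
      by (auto simp: coset_stab_def)
    also have "c ` {1..card S} = S" using c by (simp add: bij_betw_def)
    finally show ?thesis using conj by simp
  qed
  ultimately show ?thesis by simp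
qed

end

theorem theorem1p5:
  fixes G :: "('a, 'm) monoid_scheme" (structure) and H :: "'a set"
  assumes "group G" and "finitely_generated G" and "subgroup H G"
    and "\<exists>n::nat. n > 0 \<and> (\<forall>k>n. \<forall>g::nat \<Rightarrow> 'a.
           g ` {1..k} \<subseteq> carrier G \<and> inj_on (\<lambda>i. g i <# H) {1..k} \<longrightarrow>
           splitting_compatible G (\<Inter>i\<in>{1..k}. g i <# H #> inv (g i)))"
  shows "splitting_compatible G H"
  unfolding splitting_compatible_def
proof
  interpret group G by fact
  interpret H: subgroup H G by fact
  obtain n where n: "\<forall>k>n. \<forall>g::nat \<Rightarrow> 'a.
      g ` {1..k} \<subseteq> carrier G \<and> inj_on (\<lambda>i. g i <# H) {1..k} \<longrightarrow>
      splitting_compatible G (\<Inter>i\<in>{1..k}. g i <# H #> inv (g i))"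
    using assms(4) by (elim exE conjE)
  let ?cosets = "(\<lambda>y. y <# H) ` carrier G"
  define W where "W = (\<lambda>S. finite S \<and> S \<subseteq> ?cosets \<and> H \<in> S \<and>
    has_proper_almost_invariant H (coset_stab S))"
  assume "\<exists>A\<subseteq>carrier G. coset_proper G H A \<and> almost_invariant G H A \<and> H <#> A <#> H = A"
  then obtain A where A: "A \<subseteq> carrier G" "coset_proper G H A" "almost_invariant G H A"
    "H <#> A <#> H = A"
    by blast
  then have "bi_almost_invariant H H A"
    using assms(3) almost_invariant_iff[OF assms(3) A(1)] set_mult_sandwich_eq_iff[OF assms(3) A(1)]
    unfolding bi_almost_invariant_def by blast
  then have "has_proper_almost_invariant H (coset_stab {H})"
    using A(2) coset_stab_singleton[OF assms(3)] unfolding has_proper_almost_invariant_def by auto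
  moreover have "H \<in> ?cosets" using lcos_mult_one[OF H.subset] by (metis imageI one_closed)
  ultimately have W_H: "W {H}" by (simp add: W_def)
  show "\<exists>C K. splits_nontrivially_over G C \<and> subgroup K G \<and> K \<subseteq> H \<and> commensurable G C K"
  proof (cases "\<exists>S. W S \<and> card S > n")
    case True
    then obtain S where S: "finite S" "S \<subseteq> ?cosets" "H \<in> S" "card S > n"
      "has_proper_almost_invariant H (coset_stab S)"
      by (auto simp: W_def)
    let ?L = "coset_stab S"
    have SG: "S \<subseteq> Pow (carrier G)" using S(2) l_coset_subset_G[OF H.subset] by auto
    have L: "subgroup ?L G" by (rule coset_stab_subgroup[OF SG])
    have LH: "?L \<subseteq> H" using coset_stab_singleton[OF assms(3)] S(3) by (auto simp: coset_stab_def)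
    obtain B where B: "bi_almost_invariant H ?L B" "coset_proper G ?L B"
      using S(5) unfolding has_proper_almost_invariant_def by blast
    note BD = bi_almost_invariantD[OF B(1)]
    \<comment> \<open>Right invariance under H restricts to the smaller group \<open>?L\<close>,
      which gives the two-sided form required by the hypothesis.\<close>
    have "?L <#> B <#> ?L = B"
      using BD LH set_mult_sandwich_eq_iff[OF L BD(1)] by blast
    moreover have "almost_invariant G ?L B" using BD(4) almost_invariant_iff[OF L BD(1)] by blast
    moreover have "splitting_compatible G ?L"
      
      by (rule splitting_compatible_coset_stab[OF assms(3) S(1-3)])
        (rule n[rule_format, OF S(4) conjI])
    ultimately have "\<exists>C K. splits_nontrivially_over G C \<and> subgroup K G \<and> K \<subseteq> ?L \<and> commensurable G C K"
      using B(2) BD(1) unfolding splitting_compatible_def by blast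
    then show ?thesis using LH by blast
  next
    case False
    then have "\<forall>S. W S \<longrightarrow> card S \<le> n" by (auto simp: not_less)
    \<comment> \<open>\<open>Suc n\<close> appears because \<open>ex_has_greatest_nat\<close> takes
      a strict upper bound.\<close>
    then obtain S where S: "W S" "\<And>T. W T \<Longrightarrow> card T \<le> card S"
      using ex_has_greatest_nat[of W "{H}" card "Suc n"] W_H by (metis le_imp_less_Suc)
    show ?thesis
    proof (rule splitting_of_maximal[OF assms(3)])
      fix T assume T: "finite T" "T \<subseteq> ?cosets" "S \<subseteq> T"
        "has_proper_almost_invariant H (coset_stab T)"
      then have "W T" using S(1) by (auto simp: W_def)
      then show "T = S" using S(2)[of T] T(1,3) card_seteq[of T S] by simp
    qed (use S(1) in \<open>auto simp: W_def\<close>)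
  qed
qed

end
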